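(* Let $\{\mathcal G,\Gamma_0,\Gamma_1\}$ be a quasi boundary triple for $T\subset A^*$ with $A_j=T\upharpoonright\ker\Gamma_j$, $j=0,1$, and Weyl function $M$. Assume that $A_1$ is self-adjoint in $\mathcal H$, that there exists $\eta\in\rho(A_0)\cap\rho(A_1)\cap\mathbb R$, and that $\mathscr G_0=\operatorname{ran}(\Gamma_0\upharpoonright\ker\Gamma_1)$ and $\mathscr G_1=\operatorname{ran}(\Gamma_1\upharpoonright\ker\Gamma_0)$ are dense in $\mathcal G$. Let $\widetilde M$ be the extended Weyl function. Then the mapping $$\Theta\mapsto\widetilde A_\vartheta=A^*\upharpoonright\{f\in\operatorname{dom}A^*:\widetilde\Gamma f\in\vartheta\}\quad\text{with}\quad\vartheta=\iota_+^{-1}\Theta\iota_-+\widetilde M(\eta)$$ establishes a bijective correspondence between all closed (symmetric, self-adjoint, (maximal) dissipative, (maximal) accumulative) linear relations $\Theta$ in $\mathcal G$ and all closed (symmetric, self-adjoint, (maximal) dissipative, (maximal) accumulative, respectively) extensions $\widetilde A_\vartheta\subset A^*$ of $A$ in $\mathcal H$. Moreover, the following abstract regularity result holds: if $\Theta$ is a linear relation in $\mathcal G$, $\vartheta=\iota_+^{-1}\Theta\iota_-+\widetilde M(\eta)$, and $S$ is an operator in $\mathcal H$ such that $T\subset S\subset A^*$, then $$\operatorname{dom}\Theta\subset\operatorname{ran}\bigl(\iota_-\widetilde\Gamma_0\upharpoonright\operatorname{dom}S\bigr)\quad\text{implies}\quad\operatorname{dom}\widetilde A_\vartheta\subset\o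peratorname{dom}S.$$
   Context: Inner products are linear in the first and antilinear in the second argument. $\mathcal H$ is a separable Hilbert space, $A$ is a closed, densely defined, symmetric operator in $\mathcal H$ with equal (in general infinite) deficiency indices and adjoint $A^*$. Quasi boundary triple: let $T\subset A^*$ be a linear operator in $\mathcal H$ with $\overline T=A^*$. A triple $\{\mathcal G,\Gamma_0,\Gamma_1\}$ is a quasi boundary triple for $T\subset A^*$ if $\mathcal G$ is a Hilbert space and $\Gamma_0,\Gamma_1:\operatorname{dom}T\to\mathcal G$ are linear maps such that (a) $(Tf,g)_{\mathcal H}-(f,Tg)_{\mathcal H}=(\Gamma_1f,\Gamma_0g)_{\mathcal G}-(\Gamma_0f,\Gamma_1g)_{\mathcal G}$ for all $f,g\in\operatorname{dom}T$; (b) $\Gamma=(\Gamma_0,\Gamma_1)^\top:\operatorname{dom}T\to\mathcal G\times\mathcal G$ has dense range; (c) $A_0:=T\upharpoonright\ker\Gamma_0$ is self-adjoint in $\mathcal H$. For $\lambda\in\rho(A_0)$: $\gamma(\lambda):=(\Gamma_0\upharpoonright\ker(T-\lambda))^{-1}$ and the Weyl function is $M(\lambda):=\Gamma_1\gamma(\lambda)$, with domain $\operatorname{ran}\Gamma_0\subset\mathcal G$. Norms and extensions: $\mathscr G_1$ is equipped with a norm such that $\mathscr G_1$ is a reflexive Banach space continuously embedded in $\mathcal G$ and $\Gamma_1(A_0-\bar\lambda)^{-1}:\mathcal H\to\mathscr G_1$ is continuous for some (equivalently all) $\lambda\in\rho(A_0)$; $\mathscr G_0$ is equipped with a norm such that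 $\mathscr G_0$ is a reflexive Banach space continuously embedded in $\mathcal G$ and $\Gamma_0(A_1-\bar\lambda)^{-1}:\mathcal H\to\mathscr G_0$ is continuous for some (equivalently all) $\lambda\in\rho(A_1)$ (such norms exist under the density assumptions and are unique up to equivalence). $\mathscr G_j'$ is the anti-dual of $\mathscr G_j$ (continuous antilinear functionals), $\mathscr G_j\hookrightarrow\mathcal G\hookrightarrow\mathscr G_j'$, with pairings extending $(\cdot,\cdot)_{\mathcal G}$. $\widetilde\Gamma_0:\operatorname{dom}A^*\to\mathscr G_1'$ and $\widetilde\Gamma_1:\operatorname{dom}A^*\to\mathscr G_0'$ are the unique extensions of $\Gamma_0,\Gamma_1$ that are continuous in the graph norm of $A^*$ (they exist and are surjective), and $\widetilde\Gamma=(\widetilde\Gamma_0,\widetilde\Gamma_1)^\top$. For $\lambda\in\rho(A_0)$, $\widetilde\Gamma_0\upharpoonright\ker(A^*-\lambda)$ is injective with range $\mathscr G_1'$; $\widetilde\gamma(\lambda):=(\widetilde\Gamma_0\upharpoonright\ker(A^*-\lambda))^{-1}:\mathscr G_1'\to\mathcal H$ and $\widetilde M(\lambda):=\widetilde\Gamma_1\widetilde\gamma(\lambda):\mathscr G_1'\to\mathscr G_0'$ is the extended Weyl function. $\iota_+:\mathscr G_1\to\mathcal G$ and $\iota_-:\mathscr G_1'\to\mathcal G$ are isometric isomorphisms with $(\iota_-x',\iota_+x)_{\mathcal G}=\langle x',x\rangle_{\mathscr G_1'\times\mathscr G_1}$ for $x\in\mathscr G_1$, $x'\in\mathscr G_1'$.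 Linear relations: a (closed) linear relation $\Theta$ in $\mathcal G$ is a (closed) linear subspace of $\mathcal G\times\mathcal G$; operators are identified with their graphs. $\operatorname{dom}\Theta=\{x:(x,x')^\top\in\Theta\text{ for some }x'\}$. Sum: $\Theta_1+\Theta_2=\{(x,x'+x'')^\top:(x,x')^\top\in\Theta_1,(x,x'')^\top\in\Theta_2\}$; product: $\Theta_2\Theta_1=\{(x,x'')^\top:(x,x')^\top\in\Theta_1,(x',x'')^\top\in\Theta_2\}$; so $\iota_+^{-1}\Theta\iota_-=\{(h,\iota_+^{-1}x')^\top:(\iota_-h,x')^\top\in\Theta\}\subset\mathscr G_1'\times\mathscr G_1$, and $\vartheta\subset\mathscr G_1'\times\mathscr G_0'$. Adjoint: $\Theta^*=\{(y,y')^\top:(x',y)=(x,y')\text{ for all }(x,x')^\top\in\Theta\}$. $\Theta$ is symmetric if $\Theta\subset\Theta^*$, self-adjoint if $\Theta=\Theta^*$, dissipative (accumulative) if $\operatorname{Im}(x',x)\ge0$ ($\le0$) for all $(x,x')^\top\in\Theta$, and maximal dissipative (accumulative) if it is dissipative (accumulative) without proper dissipative (accumulative) extensions; likewise for operators. The parenthetical list means that the correspondence holds for each of the listed properties separately, with the same property on both sides. *)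

theory Defs
  imports "HOL-Analysis.Analysis" "HOL-Library.Function_Algebras" "HOL-Library.Equipollence"
begin

section \<open>Complex vector spaces and complex Hilbert spaces\<close>

class complex_vector = ab_group_add +
  fixes scaleC :: "complex \<Rightarrow> 'a \<Rightarrow> 'a"  (infixr \<open>*\<^sub>C\<close> 75)
  assumes scaleC_add_right: "a *\<^sub>C (x + y) = a *\<^sub>C x + a *\<^sub>C y"
    and scaleC_add_left: "(a + b) *\<^sub>C x = a *\<^sub>C x + b *\<^sub>C x"
    and scaleC_scaleC: "a *\<^sub>C (b *\<^sub>C x) = (a * b) *\<^sub>C x"
    and scaleC_one: "1 *\<^sub>C x = x"

global_interpretation complex_vector: vector_space
  "scaleC :: complex \<Rightarrow> 'a \<Rightarrow> 'a :: complex_vector"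
  by unfold_locales (rule scaleC_add_right scaleC_add_left scaleC_scaleC scaleC_one)+

text \<open>The inner product is linear in the first and antilinear in the second argument. Norm and
  topology are those of the underlying real Hilbert space with inner product
  \<open>Re (cinner x y)\<close>, so \<open>norm x = sqrt (Re (cinner x x))\<close>.\<close>

class complex_hilbert = complex_vector + real_inner + complete_space +
  fixes cinner :: "'a \<Rightarrow> 'a \<Rightarrow> complex"
  assumes scaleR_eq_scaleC: "r *\<^sub>R x = complex_of_real r *\<^sub>C x"
    and cinner_add_left: "cinner (x + y) z = cinner x z + cinner y z"
    and cinner_scaleC_left: "cinner (a *\<^sub>C x) y = a * cinner x y"
    and cinner_commute: "cinner x y = cnj (cinner y x)"
    and inner_eq_Re_cinner: "inner x y = Re (cinner x y)"

instantiation complex :: complex_hilbert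
begin
definition scaleC_complex :: "complex \<Rightarrow> complex \<Rightarrow> complex"
  where "scaleC_complex a x = a * x"
definition cinner_complex :: "complex \<Rightarrow> complex \<Rightarrow> complex"
  where "cinner_complex x y = x * cnj y"
instance
  by standard (simp_all add: scaleC_complex_def cinner_complex_def inner_complex_def
      algebra_simps scaleR_conv_of_real)
end

instantiation prod :: (complex_vector, complex_vector) complex_vector
begin
definition scaleC_prod :: "complex \<Rightarrow> 'a \<times> 'b \<Rightarrow> 'a \<times> 'b"
  where "scaleC_prod a x = (a *\<^sub>C fst x, a *\<^sub>C snd x)"
instance
  by standard (simp_all add: scaleC_prod_def prod_eq_iff scaleC_add_right scaleC_add_left
      scaleC_scaleC scaleC_one)
end

instantiation "fun" :: (type, complex_vector) complex_vector
begin
definition scaleC_fun :: "complex \<Rightarrow> ('a \<Rightarrow> 'b) \<Rightarrow> 'a \<Rightarrow> 'b"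
  where "scaleC_fun a f = (\<lambda>x. a *\<^sub>C f x)"
instance
  by standard (simp_all add: scaleC_fun_def fun_eq_iff scaleC_add_right scaleC_add_left
      scaleC_scaleC scaleC_one)
end

definition clinear_on :: "'a::complex_vector set \<Rightarrow> ('a \<Rightarrow> 'b::complex_vector) \<Rightarrow> bool" where
  "clinear_on V f \<longleftrightarrow>
     (\<forall>x\<in>V. \<forall>y\<in>V. f (x + y) = f x + f y) \<and> (\<forall>a. \<forall>x\<in>V. f (a *\<^sub>C x) = a *\<^sub>C f x)"

definition antilinear_on :: "'a::complex_vector set \<Rightarrow> ('a \<Rightarrow> complex) \<Rightarrow> bool" where
  "antilinear_on V f \<longleftrightarrow>
     (\<forall>x\<in>V. \<forall>y\<in>V. f (x + y) = f x + f y) \<and> (\<forall>a. \<forall>x\<in>V. f (a *\<^sub>C x) = cnj a * f x)"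

section \<open>Linear relations and operators\<close>

text \<open>Operators are identified with their graphs. The product \<open>\<Theta>\<^sub>2 \<Theta>\<^sub>1\<close> of relations is
  \<open>\<Theta>\<^sub>1 O \<Theta>\<^sub>2\<close>, the inverse is \<open>\<Theta>\<inverse>\<close>, and \<open>dom \<Theta>\<close> is \<open>Domain \<Theta>\<close>.\<close>

abbreviation linear_relation :: "('a::complex_vector \<times> 'b::complex_vector) set \<Rightarrow> bool" where
  "linear_relation \<Theta> \<equiv> complex_vector.subspace \<Theta>"

definition linear_operator :: "('a::complex_vector \<times> 'b::complex_vector) set \<Rightarrow> bool" where
  "linear_operator S \<longleftrightarrow> linear_relation S \<and> single_valued S"

definition graph_on :: "'a set \<Rightarrow> ('a \<Rightarrow> 'b) \<Rightarrow> ('a \<times> 'b) set" where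
  "graph_on V f = {(x, f x) | x. x \<in> V}"

definition rel_sum :: "('a \<times> 'b::plus) set \<Rightarrow> ('a \<times> 'b) set \<Rightarrow> ('a \<times> 'b) set" where
  "rel_sum \<Theta>\<^sub>1 \<Theta>\<^sub>2 = {(x, x' + x'') | x x' x''. (x, x') \<in> \<Theta>\<^sub>1 \<and> (x, x'') \<in> \<Theta>\<^sub>2}"

definition rel_adjoint :: "('a::complex_hilbert \<times> 'a) set \<Rightarrow> ('a \<times> 'a) set" where
  "rel_adjoint \<Theta> = {(y, y'). \<forall>(x, x') \<in> \<Theta>. cinner x' y = cinner x y'}"

definition symmetric :: "('a::complex_hilbert \<times> 'a) set \<Rightarrow> bool" where
  "symmetric \<Theta> \<longleftrightarrow> \<Theta> \<subseteq> rel_adjoint \<Theta>"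

definition self_adjoint :: "('a::complex_hilbert \<times> 'a) set \<Rightarrow> bool" where
  "self_adjoint \<Theta> \<longleftrightarrow> \<Theta> = rel_adjoint \<Theta>"

definition dissipative :: "('a::complex_hilbert \<times> 'a) set \<Rightarrow> bool" where
  "dissipative \<Theta> \<longleftrightarrow> (\<forall>(x, x') \<in> \<Theta>. Im (cinner x' x) \<ge> 0)"

definition accumulative :: "('a::complex_hilbert \<times> 'a) set \<Rightarrow> bool" where
  "accumulative \<Theta> \<longleftrightarrow> (\<forall>(x, x') \<in> \<Theta>. Im (cinner x' x) \<le> 0)"

text \<open>The predicate \<open>C\<close> is the class in which extensions are taken: \<^const>\<open>linear_relation\<close>
  or \<^const>\<open>linear_operator\<close>.\<close>

definition maximal_dissipative ::
    "(('a::complex_hilbert \<times> 'a) set \<Rightarrow> bool) \<Rightarrow> ('a \<times> 'a) set \<Rightarrow> bool" where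
  "maximal_dissipative C \<Theta> \<longleftrightarrow>
     dissipative \<Theta> \<and> (\<forall>\<Theta>'. C \<Theta>' \<and> dissipative \<Theta>' \<and> \<Theta> \<subseteq> \<Theta>' \<longrightarrow> \<Theta>' = \<Theta>)"

definition maximal_accumulative ::
    "(('a::complex_hilbert \<times> 'a) set \<Rightarrow> bool) \<Rightarrow> ('a \<times> 'a) set \<Rightarrow> bool" where
  "maximal_accumulative C \<Theta> \<longleftrightarrow>
     accumulative \<Theta> \<and> (\<forall>\<Theta>'. C \<Theta>' \<and> accumulative \<Theta>' \<and> \<Theta> \<subseteq> \<Theta>' \<longrightarrow> \<Theta>' = \<Theta>)"

definition eigenspace :: "('a::complex_vector \<times> 'a) set \<Rightarrow> complex \<Rightarrow> 'a set" where
  "eigenspace S z = {f. (f, z *\<^sub>C f) \<in> S}"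

text \<open>\<open>resolvent S z h\<close> is the solution \<open>f\<close> of \<open>(S - z) f = h\<close>; it is meaningful only for
  \<open>z\<close> in the resolvent set.\<close>

definition resolvent :: "('a::complex_vector \<times> 'a) set \<Rightarrow> complex \<Rightarrow> 'a \<Rightarrow> 'a" where
  "resolvent S z h = (THE f. (f, h + z *\<^sub>C f) \<in> S)"

definition resolvent_set :: "('a::complex_hilbert \<times> 'a) set \<Rightarrow> complex set" where
  "resolvent_set S =
     {z. (\<forall>h. \<exists>!f. (f, h + z *\<^sub>C f) \<in> S) \<and> bounded_linear (resolvent S z)}"

definition orthonormal_basis :: "'a::complex_hilbert set \<Rightarrow> 'a set \<Rightarrow> bool" where
  "orthonormal_basis V B \<longleftrightarrow> B \<subseteq> V \<and>
     (\<forall>x\<in>B. \<forall>y\<in>B. cinner x y = (if x = y then 1 else 0)) \<and>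
     closure (complex_vector.span B) = V"

text \<open>Equality of the Hilbert space dimensions of \<open>ker (A\<^sup>* - \<i>)\<close> and \<open>ker (A\<^sup>* + \<i>)\<close>.\<close>

definition equal_deficiency_indices :: "('a::complex_hilbert \<times> 'a) set \<Rightarrow> bool" where
  "equal_deficiency_indices A \<longleftrightarrow>
     (\<exists>B\<^sub>1 B\<^sub>2. orthonormal_basis (eigenspace (rel_adjoint A) \<i>) B\<^sub>1 \<and>
             orthonormal_basis (eigenspace (rel_adjoint A) (- \<i>)) B\<^sub>2 \<and> B\<^sub>1 \<approx> B\<^sub>2)"

definition intermediate_extension ::
    "('a::complex_hilbert \<times> 'a) set \<Rightarrow> ('a \<times> 'a) set \<Rightarrow> bool" where
  "intermediate_extension A E \<longleftrightarrow> linear_operator E \<and> A \<subseteq> E \<and> E \<subseteq> rel_adjoint A"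

section \<open>Normed subspaces and anti-duals\<close>

definition norm_on :: "'a::complex_vector set \<Rightarrow> ('a \<Rightarrow> real) \<Rightarrow> bool" where
  "norm_on V N \<longleftrightarrow>
     (\<forall>x\<in>V. 0 \<le> N x) \<and> (\<forall>x\<in>V. N x = 0 \<longleftrightarrow> x = 0) \<and>
     (\<forall>x\<in>V. \<forall>y\<in>V. N (x + y) \<le> N x + N y) \<and> (\<forall>a. \<forall>x\<in>V. N (a *\<^sub>C x) = cmod a * N x)"

definition banach_on :: "'a::complex_vector set \<Rightarrow> ('a \<Rightarrow> real) \<Rightarrow> bool" where
  "banach_on V N \<longleftrightarrow> complex_vector.subspace V \<and> norm_on V N \<and>
     (\<forall>X::nat \<Rightarrow> 'a. (\<forall>n. X n \<in> V) \<and> (\<forall>e>0. \<exists>K. \<forall>m\<ge>K. \<forall>n\<ge>K. N (X m - X n) < e) \<longrightarrow>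
        (\<exists>x\<in>V. (\<lambda>n. N (X n - x)) \<longlonglongrightarrow> 0))"

text \<open>Functionals on \<open>V\<close> are represented by functions vanishing outside \<open>V\<close>, so that they are
  determined by their values on \<open>V\<close>; the vector space operations are pointwise.\<close>

definition antidual :: "'a::complex_vector set \<Rightarrow> ('a \<Rightarrow> real) \<Rightarrow> ('a \<Rightarrow> complex) set" where
  "antidual V N = {\<phi>. antilinear_on V \<phi> \<and> (\<exists>C. \<forall>x\<in>V. cmod (\<phi> x) \<le> C * N x) \<and>
     (\<forall>x. x \<notin> V \<longrightarrow> \<phi> x = 0)}"

definition dual_norm :: "'a set \<Rightarrow> ('a \<Rightarrow> real) \<Rightarrow> ('a \<Rightarrow> complex) \<Rightarrow> real" where
  "dual_norm V N \<phi> = (SUP x\<in>{x\<in>V. N x \<le> 1}. cmod (\<phi> x))"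

text \<open>Surjectivity of the canonical map into the anti-dual of the anti-dual; the conjugate makes
  this map linear.\<close>

definition reflexive_on :: "'a::complex_vector set \<Rightarrow> ('a \<Rightarrow> real) \<Rightarrow> bool" where
  "reflexive_on V N \<longleftrightarrow>
     (\<forall>F \<in> antidual (antidual V N) (dual_norm V N).
        \<exists>x\<in>V. \<forall>\<phi>\<in>antidual V N. F \<phi> = cnj (\<phi> x))"

definition continuously_embedded :: "'a::real_normed_vector set \<Rightarrow> ('a \<Rightarrow> real) \<Rightarrow> bool" where
  "continuously_embedded V N \<longleftrightarrow> (\<exists>C. \<forall>x\<in>V. norm x \<le> C * N x)"

text \<open>The embedding of the Hilbert space into the anti-dual of a subspace \<open>V\<close>.\<close>

definition antidual_embed :: "'a::complex_hilbert set \<Rightarrow> 'a \<Rightarrow> 'a \<Rightarrow> complex" where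
  "antidual_embed V g = (\<lambda>x. if x \<in> V then cinner g x else 0)"

definition isometric_isomorphism_on ::
    "'a::complex_vector set \<Rightarrow> ('a \<Rightarrow> real) \<Rightarrow> ('a \<Rightarrow> 'b::complex_hilbert) \<Rightarrow> bool" where
  "isometric_isomorphism_on V N \<iota> \<longleftrightarrow>
     clinear_on V \<iota> \<and> bij_betw \<iota> V UNIV \<and> (\<forall>x\<in>V. norm (\<iota> x) = N x)"

section \<open>Quasi boundary triples\<close>

text \<open>Boundary maps are total functions of which only the values on \<open>Domain T\<close> matter.\<close>

definition boundary_kernel :: "('h \<times> 'h) set \<Rightarrow> ('h \<Rightarrow> 'g::zero) \<Rightarrow> 'h set" where
  "boundary_kernel T \<Gamma> = {f \<in> Domain T. \<Gamma> f = 0}"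

definition restrict_op :: "('h \<times> 'h) set \<Rightarrow> 'h set \<Rightarrow> ('h \<times> 'h) set" where
  "restrict_op T D = {(f, f') \<in> T. f \<in> D}"

definition quasi_boundary_triple ::
    "('h::complex_hilbert \<times> 'h) set \<Rightarrow> ('h \<times> 'h) set \<Rightarrow>
     ('h \<Rightarrow> 'g::complex_hilbert) \<Rightarrow> ('h \<Rightarrow> 'g) \<Rightarrow> bool" where
  "quasi_boundary_triple A T \<Gamma>\<^sub>0 \<Gamma>\<^sub>1 \<longleftrightarrow>
     linear_operator T \<and> T \<subseteq> rel_adjoint A \<and> closure T = rel_adjoint A \<and>
     clinear_on (Domain T) \<Gamma>\<^sub>0 \<and> clinear_on (Domain T) \<Gamma>\<^sub>1 \<and>
     (\<forall>(f, f') \<in> T. \<forall>(g, g') \<in> T.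
        cinner f' g - cinner f g' = cinner (\<Gamma>\<^sub>1 f) (\<Gamma>\<^sub>0 g) - cinner (\<Gamma>\<^sub>0 f) (\<Gamma>\<^sub>1 g)) \<and>
     closure ((\<lambda>f. (\<Gamma>\<^sub>0 f, \<Gamma>\<^sub>1 f)) ` Domain T) = UNIV \<and>
     self_adjoint (restrict_op T (boundary_kernel T \<Gamma>\<^sub>0))"

text \<open>\<open>\<gamma>(z) = (\<Gamma>\<^sub>0 \<restriction> ker (T - z))\<inverse>\<close> and \<open>M(z) = \<Gamma>\<^sub>1 \<gamma>(z)\<close>, as graphs. For \<open>T = A\<^sup>*\<close> and the extended
  boundary maps these are the extended \<open>\<gamma>\<close>-field and the extended Weyl function.\<close>

definition gamma_field ::
    "('h::complex_vector \<times> 'h) set \<Rightarrow> ('h \<Rightarrow> 'a) \<Rightarrow> complex \<Rightarrow> ('a \<times> 'h) set" where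
  "gamma_field T \<Gamma>\<^sub>0 z = (graph_on (eigenspace T z) \<Gamma>\<^sub>0)\<inverse>"

definition weyl_function ::
    "('h::complex_vector \<times> 'h) set \<Rightarrow> ('h \<Rightarrow> 'a) \<Rightarrow> ('h \<Rightarrow> 'b) \<Rightarrow> complex \<Rightarrow> ('a \<times> 'b) set" where
  "weyl_function T \<Gamma>\<^sub>0 \<Gamma>\<^sub>1 z = gamma_field T \<Gamma>\<^sub>0 z O graph_on (Domain T) \<Gamma>\<^sub>1"

text \<open>\<open>N\<close> is a norm on \<open>V\<close> as required of \<open>V = ran (\<Gamma> \<restriction> dom B)\<close>, where \<open>B\<close> is the restriction of
  \<open>T\<close> to the kernel of the other boundary map.\<close>

definition boundary_norm ::
    "('h::complex_hilbert \<times> 'h) set \<Rightarrow> ('h \<Rightarrow> 'g::complex_hilbert) \<Rightarrow> 'g set \<Rightarrow> ('g \<Rightarrow> real) \<Rightarrow>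
     bool" where
  "boundary_norm B \<Gamma> V N \<longleftrightarrow>
     banach_on V N \<and> reflexive_on V N \<and> continuously_embedded V N \<and>
     (\<exists>z\<in>resolvent_set B. \<exists>C. \<forall>h. N (\<Gamma> (resolvent B (cnj z) h)) \<le> C * norm h)"

text \<open>\<open>\<Gamma>'\<close> is the extension of \<open>\<Gamma>\<close> from \<open>dom T\<close> to \<open>dom S\<close>, with values in the anti-dual of \<open>V\<close>,
  that is continuous in the graph norm of \<open>S\<close>; the graph norm of \<open>f\<close> is the norm of the pair
  \<open>(f, S f)\<close>.\<close>

definition extended_boundary_map ::
    "('h::complex_hilbert \<times> 'h) set \<Rightarrow> ('h \<times> 'h) set \<Rightarrow> ('h \<Rightarrow> 'g::complex_hilbert) \<Rightarrow>
     'g set \<Rightarrow> ('g \<Rightarrow> real) \<Rightarrow> ('h \<Rightarrow> 'g \<Rightarrow> complex) \<Rightarrow> bool" where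
  "extended_boundary_map S T \<Gamma> V N \<Gamma>' \<longleftrightarrow>
     clinear_on (Domain S) \<Gamma>' \<and> \<Gamma>' ` Domain S \<subseteq> antidual V N \<and>
     (\<exists>C. \<forall>(f, f') \<in> S. dual_norm V N (\<Gamma>' f) \<le> C * norm (f, f')) \<and>
     (\<forall>f \<in> Domain T. \<Gamma>' f = antidual_embed V (\<Gamma> f))"

text \<open>\<open>\<iota>p\<inverse> \<Theta> \<iota>m\<close>, a relation between \<open>W = V\<^sub>1'\<close> and \<open>V\<^sub>1\<close>; \<open>\<iota>p\<close> and
  \<open>\<iota>m\<close> stand for \<open>\<iota>\<^sub>+\<close> and \<open>\<iota>\<^sub>-\<close>.\<close>

definition iota_transform ::
    "'w set \<Rightarrow> ('w \<Rightarrow> 'g) \<Rightarrow> 'g set \<Rightarrow> ('g \<Rightarrow> 'g) \<Rightarrow> ('g \<times> 'g) set \<Rightarrow> ('w \<times> 'g) set" where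
  "iota_transform W \<iota>m V\<^sub>1 \<iota>p \<Theta> = graph_on W \<iota>m O \<Theta> O (graph_on V\<^sub>1 \<iota>p)\<inverse>"

text \<open>\<open>\<iota>p\<inverse> \<Theta> \<iota>m + M\<close> as a relation from \<open>V\<^sub>1'\<close> to \<open>V\<^sub>0'\<close>; the values of the first summand are taken
  into \<open>V\<^sub>0'\<close> by the embedding of the Hilbert space.\<close>

definition boundary_parameter ::
    "'g::complex_hilbert set \<Rightarrow> ('g \<Rightarrow> complex) set \<Rightarrow> (('g \<Rightarrow> complex) \<Rightarrow> 'g) \<Rightarrow>
     'g set \<Rightarrow> ('g \<Rightarrow> 'g) \<Rightarrow> (('g \<Rightarrow> complex) \<times> ('g \<Rightarrow> complex)) set \<Rightarrow>
     ('g \<times> 'g) set \<Rightarrow> (('g \<Rightarrow> complex) \<times> ('g \<Rightarrow> complex)) set" where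
  "boundary_parameter V\<^sub>0 W \<iota>m V\<^sub>1 \<iota>p M \<Theta> =
     rel_sum (iota_transform W \<iota>m V\<^sub>1 \<iota>p \<Theta> O graph_on V\<^sub>1 (antidual_embed V\<^sub>0)) M"

definition boundary_restriction ::
    "('h \<times> 'h) set \<Rightarrow> ('h \<Rightarrow> 'a) \<Rightarrow> ('h \<Rightarrow> 'b) \<Rightarrow> ('a \<times> 'b) set \<Rightarrow> ('h \<times> 'h) set" where
  "boundary_restriction S \<Gamma>\<^sub>0 \<Gamma>\<^sub>1 \<theta> = restrict_op S {f \<in> Domain S. (\<Gamma>\<^sub>0 f, \<Gamma>\<^sub>1 f) \<in> \<theta>}"

end

theory Submission
  imports Defs
begin

text \<open>
  The relation \<open>\<vartheta>\<close> is built so that, seen through the right pair of boundary maps, the condition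
  \<open>(\<Gamma>\<^sub>0' f, \<Gamma>\<^sub>1' f) \<in> \<vartheta>\<close> becomes the plain condition that two boundary values in the Hilbert space \<open>\<G>\<close>
  satisfy \<open>\<Theta>\<close>. Since \<open>\<eta>\<close> lies in the resolvent set of \<open>A\<^sub>0\<close>, each \<open>f \<in> dom A\<^sup>*\<close> is uniquely
  \<open>f = f\<^sub>0 + f\<^sub>\<eta>\<close> with \<open>f\<^sub>0 = (A\<^sub>0 - \<eta>)\<inverse> (A\<^sup>* - \<eta>) f \<in> dom A\<^sub>0\<close> and \<open>f\<^sub>\<eta> \<in> ker (A\<^sup>* - \<eta>)\<close>. Here
  \<open>\<Gamma>\<^sub>0' f = \<Gamma>\<^sub>0' f\<^sub>\<eta>\<close>, and adding the extended Weyl function at \<open>\<eta>\<close> to a relation amounts to subtracting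
  \<open>\<Gamma>\<^sub>1' f\<^sub>\<eta>\<close> from \<open>\<Gamma>\<^sub>1' f\<close>, which leaves the value \<open>\<Gamma>\<^sub>1 f\<^sub>0 \<in> G\<^sub>1\<close>. So the boundary maps to use are
  \<open>\<iota>\<^sub>- \<Gamma>\<^sub>0' f\<close> and \<open>\<iota>\<^sub>+ \<Gamma>\<^sub>1 f\<^sub>0\<close> (lemma \<open>boundary_restriction_eq_extension\<close>).

  These two maps form an ordinary boundary triple: they are jointly surjective and satisfy Green's
  identity on all of \<open>dom A\<^sup>*\<close> (lemmas \<open>reg_surj\<close> and \<open>reg_Green\<close>). Both facts come from one formula,
  \<open>(f, h) = \<langle>\<Gamma>\<^sub>0' f, \<Gamma>\<^sub>1 (A\<^sub>0 - \<eta>)\<inverse> h\<rangle>\<close> for \<open>f \<in> ker (A\<^sup>* - \<eta>)\<close> and all \<open>h\<close> (lemma \<open>cinner_ker_\<eta>\<close>), which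
  extends Green's identity from \<open>T\<close> to \<open>A\<^sup>*\<close> by density in the graph norm. It makes \<open>\<Gamma>\<^sub>0'\<close>
  injective on \<open>ker (A\<^sup>* - \<eta>)\<close>, and with the Riesz representation theorem it produces for each
  functional \<open>\<phi>\<close> on \<open>G\<^sub>1\<close> an element of that kernel with \<open>\<Gamma>\<^sub>0' f = \<phi>\<close>.

  For an ordinary boundary triple the correspondence is algebraic. By surjectivity, and because the
  common kernel of the boundary maps is \<open>dom A\<close>, the linear relations in \<open>\<G>\<close> correspond to the
  intermediate extensions of \<open>A\<close>, preserving inclusions in both directions. Green's identity shows that
  the correspondence commutes with taking adjoints (lemma \<open>adjoint_extension\<close>) and preserves
  \<open>Im (f', f)\<close>. Symmetry, self-adjointness and dissipativity are therefore the same on both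
  sides; so is closedness, which for subspaces means equality with the double adjoint. For maximality there remains the fact
  that every dissipative extension of the densely defined symmetric operator \<open>A\<close> is contained in
  \<open>A\<^sup>*\<close>, so that all competitors are intermediate extensions.

  The regularity assertion follows from the decomposition: if \<open>g \<in> dom S\<close> has \<open>\<Gamma>\<^sub>0' g = \<Gamma>\<^sub>0' f\<close>, then
  \<open>f\<^sub>\<eta> = g\<^sub>\<eta>\<close>, so \<open>f - g \<in> dom A\<^sub>0 \<subseteq> dom T \<subseteq> dom S\<close>.
\<close>

section \<open>Inner products, orthogonality and representation of functionals\<close>

lemma cinner_add_right: "cinner x (y + z) = cinner x y + cinner (x::'a::complex_hilbert) z"
  by (metis cinner_add_left cinner_commute complex_cnj_add)

lemma cinner_scaleC_right: "cinner x (a *\<^sub>C y) = cnj a * cinner (x::'a::complex_hilbert) y"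
  by (metis cinner_scaleC_left cinner_commute complex_cnj_mult)

lemma cinner_zero_left [simp]: "cinner 0 (x::'a::complex_hilbert) = 0"
  using cinner_add_left[of 0 0 x] by simp

lemma cinner_zero_right [simp]: "cinner (x::'a::complex_hilbert) 0 = 0"
  using cinner_add_right[of x 0 0] by simp

lemma cinner_diff_left: "cinner (x - y) z = cinner x z - cinner y (z::'a::complex_hilbert)"
  using cinner_add_left[of "x - y" y z] by (simp add: algebra_simps)

lemma cinner_diff_right: "cinner x (y - z) = cinner x y - cinner x (z::'a::complex_hilbert)"
  using cinner_add_right[of x "y - z" z] by (simp add: algebra_simps)

lemma cinner_minus_left: "cinner (- x) y = - cinner x (y::'a::complex_hilbert)"
  using cinner_diff_left[of 0 x y] by simp

lemma cinner_minus_right: "cinner x (- y) = - cinner x (y::'a::complex_hilbert)"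
  using cinner_diff_right[of x 0 y] by simp

lemmas cinner_simps = cinner_add_left cinner_add_right cinner_diff_left cinner_diff_right
  cinner_minus_left cinner_minus_right cinner_scaleC_left cinner_scaleC_right

lemma norm_scaleC: "norm (a *\<^sub>C x) = cmod a * norm (x::'a::complex_hilbert)"
proof -
  have "Re (cinner (a *\<^sub>C x) (a *\<^sub>C x)) = (cmod a)\<^sup>2 * Re (cinner x x)"
    unfolding cmod_power2 by (simp add: cinner_simps algebra_simps power2_eq_square)
  then have "(norm (a *\<^sub>C x))\<^sup>2 = (cmod a * norm x)\<^sup>2"
    by (simp add: power2_norm_eq_inner inner_eq_Re_cinner power_mult_distrib)
  then show ?thesis by simp
qed

lemma cinner_Cauchy_Schwarz: "cmod (cinner x y) \<le> norm x * norm (y::'a::complex_hilbert)"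
proof -
  (* the phase that makes the inner product real and non-negative *)
  define c where "c = cnj (sgn (cinner x y))"
  have c: "cmod c \<le> 1" by (simp add: c_def norm_sgn)
  have "c * cinner x y = complex_of_real (cmod (cinner x y))"
    by (cases "cinner x y = 0")
      (simp_all add: c_def sgn_eq field_simps power2_eq_square flip: complex_norm_square)
  then have "cmod (cinner x y) = inner (c *\<^sub>C x) y"
    by (simp add: inner_eq_Re_cinner cinner_simps)
  also have "\<dots> \<le> norm (c *\<^sub>C x) * norm y" by (rule norm_cauchy_schwarz)
  also have "\<dots> \<le> norm x * norm y"
    using c by (intro mult_right_mono) (auto simp: norm_scaleC intro: mult_left_le_one_le)
  finally show ?thesis .
qed

lemma bounded_linear_cinner_left: "bounded_linear (\<lambda>x. cinner x (y::'a::complex_hilbert))"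
  by (rule bounded_linear_intro[where K = "norm y"])
    (auto simp: cinner_simps scaleR_eq_scaleC scaleC_complex_def cinner_Cauchy_Schwarz)

lemma bounded_linear_cinner_right: "bounded_linear (\<lambda>y. cinner (x::'a::complex_hilbert) y)"
  by (rule bounded_linear_intro[where K = "norm x"])
    (auto simp: cinner_simps scaleR_eq_scaleC scaleC_complex_def mult.commute
      intro: order_trans[OF cinner_Cauchy_Schwarz])

lemmas tendsto_cinner_left = bounded_linear.tendsto[OF bounded_linear_cinner_left]
lemmas continuous_on_cinner_right = bounded_linear.continuous_on[OF bounded_linear_cinner_right]

lemma cinner_self_eq_0_iff [simp]: "cinner x x = 0 \<longleftrightarrow> (x::'a::complex_hilbert) = 0"
  using inner_eq_zero_iff[of x] inner_eq_Re_cinner[of x x] by auto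

lemma orthogonal_to_dense_eq_0:
  fixes y :: "'a::complex_hilbert"
  assumes "closure D = UNIV" "\<And>x. x \<in> D \<Longrightarrow> cinner y x = 0"
  shows "y = 0"
proof -
  have "closed {x. cinner y x = 0}"
    by (intro closed_Collect_eq continuous_on_cinner_right continuous_on_const continuous_on_id)
  then have "closure D \<subseteq> {x. cinner y x = 0}"
    using assms(2) by (intro closure_minimal) auto
  then have "y \<in> {x. cinner y x = 0}" using assms(1) by blast
  then have "cinner y y = 0" by blast
  then show ?thesis by simp
qed

text \<open>The vector sought is \<open>x - p\<close>, where \<open>p\<close> is the point of \<open>S\<close> nearest to \<open>x\<close>; by the parallelogram
  law a minimizing sequence for the distance is Cauchy.\<close>

lemma closed_subspace_separation:
  fixes S :: "'a::{real_inner, complete_space} set"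
  assumes "subspace S" "closed S" "x \<notin> S"
  shows "\<exists>v. (\<forall>y\<in>S. inner v y = 0) \<and> inner v x \<noteq> 0"
proof -
  define d where "d = infdist x S"
  have ne: "S \<noteq> {}" using subspace_0[OF assms(1)] by auto
  have d_le: "d \<le> norm (y - x)" if "y \<in> S" for y
    using infdist_le[OF that, of x] by (simp add: d_def dist_norm norm_minus_commute)
  have "\<exists>y\<in>S. norm (y - x) < d + 1 / Suc n" for n
    using cInf_lessD[of "dist x ` S" "d + 1 / Suc n"] ne
    by (auto simp: d_def infdist_notempty dist_norm norm_minus_commute)
  then obtain Y where Y: "\<And>n. Y n \<in> S" "\<And>n. norm (Y n - x) < d + 1 / Suc n"
    by metis
  have d0: "d \<ge> 0" by (simp add: d_def infdist_nonneg)
  (* parallelogram law: the midpoint of two almost nearest points is still at distance at least d *)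
  have para: "(norm (y - z))\<^sup>2 \<le> 2 * (norm (y - x))\<^sup>2 + 2 * (norm (z - x))\<^sup>2 - 4 * d\<^sup>2"
    if "y \<in> S" "z \<in> S" for y z
  proof -
    have "(1/2) *\<^sub>R (y + z) \<in> S"
      using that assms(1) by (simp add: subspace_add subspace_scale)
    then have "d\<^sup>2 \<le> (norm ((1/2) *\<^sub>R (y + z) - x))\<^sup>2"
      using d_le d0 by (simp add: power_mono)
    moreover have "4 * (norm ((1/2) *\<^sub>R (y + z) - x))\<^sup>2 = (norm ((y - x) + (z - x)))\<^sup>2"
      by (simp add: power2_norm_eq_inner inner_add inner_diff algebra_simps inner_commute)
    moreover have "(norm (y - z))\<^sup>2 =
        2 * (norm (y - x))\<^sup>2 + 2 * (norm (z - x))\<^sup>2 - (norm ((y - x) + (z - x)))\<^sup>2"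
      by (simp add: power2_norm_eq_inner inner_add inner_diff algebra_simps inner_commute)
    ultimately show ?thesis by simp
  qed
  have est: "(norm (Y m - Y n))\<^sup>2 \<le> (8 * d + 4) * (1 / Suc k)" if "k \<le> m" "k \<le> n" for k m n
  proof -
    have small: "(norm (Y j - x))\<^sup>2 \<le> d\<^sup>2 + (2 * d + 1) * (1 / Suc k)" if "k \<le> j" for j
    proof -
      have jk: "1 / real (Suc j) \<le> 1 / Suc k" using that by (simp add: frac_le)
      have "norm (Y j - x) \<le> d + 1 / Suc k" using Y(2)[of j] jk by linarith
      then have "(norm (Y j - x))\<^sup>2 \<le> (d + 1 / Suc k)\<^sup>2" by (rule power_mono) simp
      also have "\<dots> = d\<^sup>2 + 2 * d * (1 / Suc k) + (1 / Suc k)\<^sup>2"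
        by (simp add: power2_sum)
      also have "(1 / real (Suc k))\<^sup>2 \<le> 1 / Suc k"
        by (simp add: power2_eq_square divide_simps)
      finally show ?thesis by (simp add: algebra_simps)
    qed
    have "(8 * d + 4) * (1 / real (Suc k)) = 4 * ((2 * d + 1) * (1 / Suc k))"
      by (simp add: field_simps)
    then show ?thesis using para[OF Y(1) Y(1), of m n] small[OF that(1)] small[OF that(2)]
      by linarith
  qed
  have "Cauchy Y"
  proof (rule metric_CauchyI)
    fix e :: real assume "e > 0"
    have "(\<lambda>k. (8 * d + 4) * (1 / real (Suc k))) \<longlonglongrightarrow> (8 * d + 4) * 0"
      by (intro tendsto_intros LIMSEQ_Suc[OF lim_1_over_n])
    moreover have "(0::real) < e\<^sup>2" using \<open>e > 0\<close> by simp
    ultimately obtain k where "(8 * d + 4) * (1 / real (Suc k)) < e\<^sup>2"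
      by (metis (no_types, lifting) eventually_sequentially mult_zero_right order_refl
          order_tendsto_iff)
    then have "(norm (Y m - Y n))\<^sup>2 < e\<^sup>2" if "k \<le> m" "k \<le> n" for m n
      using est[OF that] by linarith
    then have "\<forall>m\<ge>k. \<forall>n\<ge>k. dist (Y m) (Y n) < e"
      using \<open>e > 0\<close> by (auto simp: dist_norm intro: power2_less_imp_less)
    then show "\<exists>M. \<forall>m\<ge>M. \<forall>n\<ge>M. dist (Y m) (Y n) < e" ..
  qed
  then obtain p where p: "Y \<longlonglongrightarrow> p" using Cauchy_convergent_iff convergent_def by blast
  have pS: "p \<in> S" using closed_sequentially[OF assms(2) Y(1) p] .
  have "norm (p - x) \<le> d"
  proof (rule LIMSEQ_le)
    show "(\<lambda>n. norm (Y n - x)) \<longlonglongrightarrow> norm (p - x)" by (intro tendsto_intros p)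
    show "(\<lambda>n. d + 1 / real (Suc n)) \<longlonglongrightarrow> d"
      using tendsto_add[OF tendsto_const LIMSEQ_Suc[OF lim_1_over_n], of d] by simp
    show "\<exists>N. \<forall>n\<ge>N. norm (Y n - x) \<le> d + 1 / real (Suc n)" using Y(2) less_imp_le by blast
  qed
  then have min: "norm (p - x) \<le> norm (y - x)" if "y \<in> S" for y
    using d_le[OF that] by linarith
  define v where "v = x - p"
  have orth: "inner v y = 0" if "y \<in> S" for y
  proof (cases "y = 0")
    case False
    (* compare p with its displacement along y that minimizes the distance to x *)
    define t where "t = inner v y / inner y y"
    have yy: "inner y y > 0" using False by simp
    have "p + t *\<^sub>R y \<in> S" using pS that assms(1) by (simp add: subspace_add subspace_scale)
    from min[OF this] have "(norm (p - x))\<^sup>2 \<le> (norm (p + t *\<^sub>R y - x))\<^sup>2"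
      by (simp add: power_mono)
    also have "p + t *\<^sub>R y - x = t *\<^sub>R y - v" by (simp add: v_def)
    also have "(norm (p - x))\<^sup>2 = inner v v"
      by (simp add: v_def power2_norm_eq_inner inner_diff algebra_simps inner_commute)
    finally have "0 \<le> t * t * inner y y - 2 * t * inner v y"
      by (simp add: power2_norm_eq_inner inner_diff inner_add algebra_simps inner_commute)
    also have "\<dots> = - (inner v y)\<^sup>2 / inner y y"
      using yy by (simp add: t_def field_simps power2_eq_square)
    finally have "(inner v y)\<^sup>2 \<le> 0" using yy by (simp add: divide_le_0_iff)
    then show ?thesis by simp
  qed simp
  have "inner v x = inner v v" using orth[OF pS] by (simp add: v_def inner_diff)
  moreover have "v \<noteq> 0" using pS assms(3) by (auto simp: v_def)
  ultimately have "inner v x \<noteq> 0" by simp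
  then show ?thesis using orth by blast
qed

text \<open>A vector separating the kernel of \<open>f\<close> from a point outside represents \<open>f\<close> up to a scalar, because
  the kernel has codimension one.\<close>

lemma Riesz_representation_real:
  fixes f :: "'a::{real_inner, complete_space} \<Rightarrow> real"
  assumes "bounded_linear f"
  shows "\<exists>v. \<forall>x. f x = inner v x"
proof (cases "\<exists>x. f x \<noteq> 0")
  case True
  interpret bounded_linear f by fact
  obtain x where x: "f x \<noteq> 0" using True by auto
  have "subspace {y. f y = 0}" by (auto simp: subspace_def add scaleR zero)
  moreover have "closed {y. f y = 0}"
    by (intro closed_Collect_eq continuous_on_const linear_continuous_on assms)
  ultimately obtain v where v: "\<And>y. f y = 0 \<Longrightarrow> inner v y = 0" "inner v x \<noteq> 0"
    using closed_subspace_separation[of "{y. f y = 0}" x] x by auto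
  have "f y = inner ((f x / inner v x) *\<^sub>R v) y" for y
  proof -
    have "f (y - (f y / f x) *\<^sub>R x) = 0" using x by (simp add: diff scaleR)
    from v(1)[OF this] have "inner v y = (f y / f x) * inner v x" by (simp add: inner_diff)
    then show ?thesis using x v(2) by (simp add: field_simps)
  qed
  then show ?thesis by blast
qed (auto intro: exI[of _ 0])

text \<open>The real part determines an antilinear functional, since \<open>Im (\<psi> x) = Re (\<psi> (\<i> x))\<close>.\<close>

lemma Riesz_representation_antilinear:
  fixes \<psi> :: "'a::complex_hilbert \<Rightarrow> complex"
  assumes "antilinear_on UNIV \<psi>" and bd: "\<And>x. cmod (\<psi> x) \<le> K * norm x"
  shows "\<exists>f. \<forall>x. cinner f x = \<psi> x"
proof -
  have add: "\<psi> (x + y) = \<psi> x + \<psi> y" and sc: "\<psi> (a *\<^sub>C x) = cnj a * \<psi> x" for a x y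
    using assms(1) by (auto simp: antilinear_on_def)
  have "bounded_linear (\<lambda>x. Re (\<psi> x))"
  proof (rule bounded_linear_intro[where K = K])
    show "norm (Re (\<psi> x)) \<le> norm x * K" for x
      using abs_Re_le_cmod[of "\<psi> x"] bd[of x] by (simp add: mult.commute)
  qed (auto simp: add sc scaleR_eq_scaleC)
  then obtain f where f: "\<And>x. Re (\<psi> x) = Re (cinner f x)"
    using Riesz_representation_real by (metis inner_eq_Re_cinner)
  have "Im (\<psi> x) = Im (cinner f x)" for x
    using f[of "\<i> *\<^sub>C x"] by (simp add: sc cinner_simps)
  then show ?thesis using f by (metis complex_eqI)
qed

section \<open>Adjoints of linear relations\<close>

lemma clinear_on_add: "clinear_on V f \<Longrightarrow> x \<in> V \<Longrightarrow> y \<in> V \<Longrightarrow> f (x + y) = f x + f y"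
  by (simp add: clinear_on_def)

lemma clinear_on_scale: "clinear_on V f \<Longrightarrow> x \<in> V \<Longrightarrow> f (a *\<^sub>C x) = a *\<^sub>C f x"
  by (simp add: clinear_on_def)

lemma clinear_on_diff:
  assumes "clinear_on V f" "complex_vector.subspace V" "x \<in> V" "y \<in> V"
  shows "f (x - y) = f x - f y"
  using clinear_on_add[OF assms(1) complex_vector.subspace_diff[OF assms(2-4)] assms(4)]
  by (simp add: algebra_simps)

lemma clinear_on_zero:
  assumes "clinear_on V f" "complex_vector.subspace V"
  shows "f 0 = 0"
  using clinear_on_diff[OF assms, of 0 0] complex_vector.subspace_0[OF assms(2)] by simp

lemma linear_relation_Domain:
  assumes "linear_relation S"
  shows "complex_vector.subspace (Domain S)"
proof (rule complex_vector.subspaceI)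
  show "0 \<in> Domain S" using complex_vector.subspace_0[OF assms] by (auto simp: zero_prod_def)
next
  fix x y assume "x \<in> Domain S" "y \<in> Domain S"
  then show "x + y \<in> Domain S" using complex_vector.subspace_add[OF assms] by fastforce
next
  fix c x assume "x \<in> Domain S"
  then show "c *\<^sub>C x \<in> Domain S"
    using complex_vector.subspace_scale[OF assms] by (fastforce simp: scaleC_prod_def)
qed

lemma linear_relation_add:
  "linear_relation S \<Longrightarrow> (x, x') \<in> S \<Longrightarrow> (y, y') \<in> S \<Longrightarrow> (x + y, x' + y') \<in> S"
  using complex_vector.subspace_add[of S "(x, x')" "(y, y')"] by simp

lemma linear_relation_diff:
  "linear_relation S \<Longrightarrow> (x, x') \<in> S \<Longrightarrow> (y, y') \<in> S \<Longrightarrow> (x - y, x' - y') \<in> S"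
  using complex_vector.subspace_diff[of S "(x, x')" "(y, y')"] by simp

lemma linear_relation_scale:
  "linear_relation S \<Longrightarrow> (x, x') \<in> S \<Longrightarrow> (a *\<^sub>C x, a *\<^sub>C x') \<in> S"
  using complex_vector.subspace_scale[of S "(x, x')" a] by (simp add: scaleC_prod_def)

lemma linear_relation_zero: "linear_relation S \<Longrightarrow> (0, 0) \<in> S"
  using complex_vector.subspace_0[of S] by (simp add: zero_prod_def)

lemma linear_relationI:
  assumes "(0, 0) \<in> S" "\<And>x x' y y'. (x, x') \<in> S \<Longrightarrow> (y, y') \<in> S \<Longrightarrow> (x + y, x' + y') \<in> S"
    "\<And>a x x'. (x, x') \<in> S \<Longrightarrow> (a *\<^sub>C x, a *\<^sub>C x') \<in> S"
  shows "linear_relation S"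
  using assms by (intro complex_vector.subspaceI) (auto simp: zero_prod_def scaleC_prod_def)

lemma rel_adjoint_iff:
  "(y, y') \<in> rel_adjoint S \<longleftrightarrow> (\<forall>x x'. (x, x') \<in> S \<longrightarrow> cinner x' y = cinner x y')"
  by (auto simp: rel_adjoint_def)

lemma linear_relation_rel_adjoint: "linear_relation (rel_adjoint S)"
  by (rule linear_relationI) (auto simp: rel_adjoint_iff cinner_simps)

lemma closed_rel_adjoint: "closed (rel_adjoint S)"
proof -
  have "rel_adjoint S = (\<Inter>p\<in>S. {q. cinner (snd p) (fst q) = cinner (fst p) (snd q)})"
    by (fastforce simp: rel_adjoint_def)
  moreover have "closed {q. cinner (snd p) (fst q) = cinner (fst p) (snd q)}" for p :: "'a \<times> 'a"
    by (intro closed_Collect_eq continuous_on_cinner_right continuous_intros)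
  ultimately show ?thesis by auto
qed

lemma rel_adjoint_antimono: "S \<subseteq> R \<Longrightarrow> rel_adjoint R \<subseteq> rel_adjoint S"
  by (auto simp: rel_adjoint_def)

lemma subset_double_adjoint: "S \<subseteq> rel_adjoint (rel_adjoint S)"
  by (auto simp: rel_adjoint_iff) (metis cinner_commute)

text \<open>Up to the rotation \<open>(u, w) \<mapsto> (w, - u)\<close> the adjoint is the orthogonal complement in the product
  space, so this is the bipolar theorem for closed subspaces.\<close>

lemma double_adjoint:
  assumes "linear_relation S" "closed S"
  shows "rel_adjoint (rel_adjoint S) = S"
proof (rule ccontr)
  assume "rel_adjoint (rel_adjoint S) \<noteq> S"
  then obtain y y' where y: "(y, y') \<in> rel_adjoint (rel_adjoint S)" "(y, y') \<notin> S"
    using subset_double_adjoint[of S] by auto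
  have "subspace S"
    using linear_relation_zero[OF assms(1)] linear_relation_add[OF assms(1)]
      linear_relation_scale[OF assms(1)]
    by (auto simp: subspace_def zero_prod_def scaleR_eq_scaleC)
  then obtain v where v: "\<And>p. p \<in> S \<Longrightarrow> inner v p = 0" "inner v (y, y') \<noteq> 0"
    using closed_subspace_separation[OF _ assms(2) y(2)] by blast
  obtain u w where uw: "v = (u, w)" by force
  have re: "Re (cinner u x + cinner w x') = 0" if "(x, x') \<in> S" for x x'
    using v(1)[OF that] by (simp add: uw inner_eq_Re_cinner)
  (* a complex subspace that is orthogonal for the real inner product is so for the complex one *)
  have "cinner u x + cinner w x' = 0" if "(x, x') \<in> S" for x x'
    using re[OF that] re[OF linear_relation_scale[OF assms(1) that, of \<i>]]
    by (simp add: cinner_simps complex_eq_iff)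
  then have "cinner x' w = cinner x (- u)" if "(x, x') \<in> S" for x x'
    using that by (metis cinner_commute cinner_minus_right complex_cnj_minus eq_neg_iff_add_eq_0
        add.commute)
  then have "(w, - u) \<in> rel_adjoint S" by (simp add: rel_adjoint_iff)
  then have "cinner (- u) y = cinner w y'" using y(1) by (auto simp: rel_adjoint_iff)
  then have "cinner u y + cinner w y' = 0" by (simp add: cinner_minus_left neg_eq_iff_add_eq_0)
  then have "Re (cinner u y + cinner w y') = 0" by simp
  then show False using v(2) by (simp add: uw inner_eq_Re_cinner)
qed

lemma single_valued_rel_adjoint:
  assumes "closure (Domain A) = UNIV"
  shows "single_valued (rel_adjoint A)"
proof (rule single_valuedI)
  fix x y z assume "(x, y) \<in> rel_adjoint A" "(x, z) \<in> rel_adjoint A"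
  then have "cinner (y - z) w = 0" if "w \<in> Domain A" for w
    using that by (auto simp: rel_adjoint_iff cinner_diff_left) (metis cinner_commute)
  then have "y - z = 0" using orthogonal_to_dense_eq_0[OF assms] by blast
  then show "y = z" by simp
qed

text \<open>Dissipative for \<open>s > 0\<close>, accumulative for \<open>s < 0\<close>; the sign lets both be treated at once.\<close>

definition signed_dissipative :: "real \<Rightarrow> ('a::complex_hilbert \<times> 'a) set \<Rightarrow> bool" where
  "signed_dissipative s E \<longleftrightarrow> (\<forall>(x, x') \<in> E. 0 \<le> s * Im (cinner x' x))"

lemma dissipative_signed: "dissipative = signed_dissipative 1"
  by (auto simp: fun_eq_iff dissipative_def signed_dissipative_def)

lemma accumulative_signed: "accumulative = signed_dissipative (- 1)"
  by (auto simp: fun_eq_iff accumulative_def signed_dissipative_def)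

lemma affine_bounded_below_imp_eq_0:
  assumes "\<And>t::real. 0 \<le> a + t * b"
  shows "b = 0"
proof (rule ccontr)
  assume "b \<noteq> 0"
  then show False using assms[of "- (a + 1) / b"] by simp
qed

text \<open>For \<open>(f, f') \<in> E\<close> and \<open>(u, u') \<in> A\<close> the form \<open>Im (f' + c u', f + c u)\<close> has no quadratic term
  in \<open>c\<close>, because \<open>A\<close> is symmetric. A function that is affine in \<open>c\<close> and bounded below is constant,
  so the linear coefficient \<open>(f', u) - (f, u')\<close> vanishes.\<close>

lemma signed_dissipative_extension_subset_adjoint:
  assumes E: "linear_relation E" "signed_dissipative s E" "s \<noteq> 0" and A: "A \<subseteq> E" "symmetric A"
  shows "E \<subseteq> rel_adjoint A"
proof (clarsimp simp: rel_adjoint_iff)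
  fix f f' u u' assume f: "(f, f') \<in> E" and u: "(u, u') \<in> A"
  define w where "w = cinner f' u - cinner f u'"
  have "cinner u' u = cinner u u'" using A(2) u by (auto simp: symmetric_def rel_adjoint_iff)
  then have uu: "Im (cinner u' u) = 0"
    using cinner_commute[of u u'] by (simp add: complex_eq_iff)
  have *: "0 \<le> s * Im (cinner f' f) + s * Im (cnj c * w)" for c
  proof -
    have "(f + c *\<^sub>C u, f' + c *\<^sub>C u') \<in> E"
      using linear_relation_add[OF E(1) f linear_relation_scale[OF E(1)]] u A(1) by auto
    then have nonneg: "0 \<le> s * Im (cinner (f' + c *\<^sub>C u') (f + c *\<^sub>C u))"
      using E(2) by (auto simp: signed_dissipative_def)
    have "Im (cinner (f' + c *\<^sub>C u') (f + c *\<^sub>C u)) = Im (cinner f' f)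
        + Im (cnj c * cinner f' u) + Im (c * cinner u' f) + Im (cnj c * c * cinner u' u)"
      by (simp add: cinner_simps algebra_simps)
    moreover have "Im (c * cinner u' f) = - Im (cnj c * cinner f u')"
      using cinner_commute[of u' f] by simp
    moreover have "Im (cnj c * c * cinner u' u) = 0" using uu by (simp add: algebra_simps)
    moreover have "Im (cnj c * w) = Im (cnj c * cinner f' u) - Im (cnj c * cinner f u')"
      by (simp add: w_def algebra_simps)
    ultimately have "Im (cinner (f' + c *\<^sub>C u') (f + c *\<^sub>C u)) =
        Im (cinner f' f) + Im (cnj c * w)"
      by linarith
    with nonneg show ?thesis by (simp only: distrib_left)
  qed
  have "s * Im w = 0"
    using *[of "complex_of_real t" for t]
    by (intro affine_bounded_below_imp_eq_0[of "s * Im (cinner f' f)"]) (simp add: algebra_simps)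
  moreover have "s * Re w = 0"
    using *[of "complex_of_real t * - \<i>" for t]
    by (intro affine_bounded_below_imp_eq_0[of "s * Im (cinner f' f)"]) (simp add: algebra_simps)
  ultimately have "w = 0" using E(3) by (simp add: complex_eq_iff)
  then show "cinner u' f = cinner u f'"
    by (metis cinner_commute eq_iff_diff_eq_0 w_def)
qed

section \<open>Ordinary boundary triples\<close>

locale ordinary_boundary_triple =
  fixes A :: "('h::complex_hilbert \<times> 'h) set"
    and \<Lambda>\<^sub>0 \<Lambda>\<^sub>1 :: "'h \<Rightarrow> 'g::complex_hilbert"
  assumes linear_operator_A: "linear_operator A"
    and closed_A: "closed A"
    and dense_A: "closure (Domain A) = UNIV"
    and symmetric_A: "symmetric A"
    and clinear_\<Lambda>\<^sub>0: "clinear_on (Domain (rel_adjoint A)) \<Lambda>\<^sub>0"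
    and clinear_\<Lambda>\<^sub>1: "clinear_on (Domain (rel_adjoint A)) \<Lambda>\<^sub>1"
    and Green: "(f, f') \<in> rel_adjoint A \<Longrightarrow> (g, g') \<in> rel_adjoint A \<Longrightarrow>
      cinner f' g - cinner f g' = cinner (\<Lambda>\<^sub>1 f) (\<Lambda>\<^sub>0 g) - cinner (\<Lambda>\<^sub>0 f) (\<Lambda>\<^sub>1 g)"
    and surj: "\<exists>f\<in>Domain (rel_adjoint A). \<Lambda>\<^sub>0 f = x \<and> \<Lambda>\<^sub>1 f = y"
begin

definition extension :: "('g \<times> 'g) set \<Rightarrow> ('h \<times> 'h) set" where
  "extension \<Theta> = {(f, f') \<in> rel_adjoint A. (\<Lambda>\<^sub>0 f, \<Lambda>\<^sub>1 f) \<in> \<Theta>}"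

lemma extension_iff:
  "(f, f') \<in> extension \<Theta> \<longleftrightarrow> (f, f') \<in> rel_adjoint A \<and> (\<Lambda>\<^sub>0 f, \<Lambda>\<^sub>1 f) \<in> \<Theta>"
  by (simp add: extension_def)

lemma obtain_boundary_values:
  obtains f f' where "(f, f') \<in> rel_adjoint A" "\<Lambda>\<^sub>0 f = x" "\<Lambda>\<^sub>1 f = y"
  using surj by blast

lemma extension_subset_iff: "extension \<Theta> \<subseteq> extension \<Theta>' \<longleftrightarrow> \<Theta> \<subseteq> \<Theta>'"
proof
  assume *: "extension \<Theta> \<subseteq> extension \<Theta>'"
  show "\<Theta> \<subseteq> \<Theta>'"
  proof (rule subrelI)
    fix x y assume "(x, y) \<in> \<Theta>"
    moreover obtain f f' where "(f, f') \<in> rel_adjoint A" "\<Lambda>\<^sub>0 f = x" "\<Lambda>\<^sub>1 f = y"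
      by (rule obtain_boundary_values)
    ultimately show "(x, y) \<in> \<Theta>'" using * by (auto simp: extension_def)
  qed
qed (auto simp: extension_def)

lemma extension_eq_iff: "extension \<Theta> = extension \<Theta>' \<longleftrightarrow> \<Theta> = \<Theta>'"
  using extension_subset_iff by (metis equalityI order_refl)

text \<open>Boundary values of elements of \<open>A\<close> are annihilated by all pairs in \<open>\<G> \<times> \<G>\<close> by Green's identity
  and surjectivity; conversely vanishing boundary values put \<open>(f, f')\<close> into \<open>A\<^sup>*\<^sup>*\<close>, which is \<open>A\<close>.\<close>

lemma A_iff: "(f, f') \<in> A \<longleftrightarrow> (f, f') \<in> rel_adjoint A \<and> \<Lambda>\<^sub>0 f = 0 \<and> \<Lambda>\<^sub>1 f = 0"
proof
  assume f: "(f, f') \<in> A"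
  then have f': "(f, f') \<in> rel_adjoint A" using symmetric_A by (auto simp: symmetric_def)
  (* for these boundary values the boundary term is the sum of two squared norms *)
  obtain g g' where g: "(g, g') \<in> rel_adjoint A" "\<Lambda>\<^sub>0 g = \<Lambda>\<^sub>1 f" "\<Lambda>\<^sub>1 g = - \<Lambda>\<^sub>0 f"
    by (rule obtain_boundary_values)
  have "cinner f' g - cinner f g' = 0" using g(1) f by (auto simp: rel_adjoint_iff)
  then have "cinner (\<Lambda>\<^sub>1 f) (\<Lambda>\<^sub>1 f) + cinner (\<Lambda>\<^sub>0 f) (\<Lambda>\<^sub>0 f) = 0"
    using Green[OF f' g(1)] g(2,3) by (simp add: cinner_minus_right)
  then have "inner (\<Lambda>\<^sub>1 f) (\<Lambda>\<^sub>1 f) + inner (\<Lambda>\<^sub>0 f) (\<Lambda>\<^sub>0 f) = 0"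
    by (simp add: inner_eq_Re_cinner flip: plus_complex.sel)
  then have "\<Lambda>\<^sub>0 f = 0" "\<Lambda>\<^sub>1 f = 0"
    using inner_ge_zero[of "\<Lambda>\<^sub>0 f"] inner_ge_zero[of "\<Lambda>\<^sub>1 f"] inner_eq_zero_iff
    by (smt (verit))+
  with f' show "(f, f') \<in> rel_adjoint A \<and> \<Lambda>\<^sub>0 f = 0 \<and> \<Lambda>\<^sub>1 f = 0" by simp
next
  assume *: "(f, f') \<in> rel_adjoint A \<and> \<Lambda>\<^sub>0 f = 0 \<and> \<Lambda>\<^sub>1 f = 0"
  have "cinner g' f = cinner g f'" if "(g, g') \<in> rel_adjoint A" for g g'
    using Green[OF that, of f f'] * by simp
  then have "(f, f') \<in> rel_adjoint (rel_adjoint A)" by (simp add: rel_adjoint_iff)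
  then show "(f, f') \<in> A"
    using double_adjoint[OF _ closed_A] linear_operator_A by (simp add: linear_operator_def)
qed

lemma A_subset_extension: "(0, 0) \<in> \<Theta> \<Longrightarrow> A \<subseteq> extension \<Theta>"
  by (auto simp: extension_iff A_iff)

lemma subspace_Domain_adjoint: "complex_vector.subspace (Domain (rel_adjoint A))"
  by (rule linear_relation_Domain[OF linear_relation_rel_adjoint])

lemma single_valued_adjoint: "single_valued (rel_adjoint A)"
  by (rule single_valued_rel_adjoint[OF dense_A])

lemma linear_relation_extension:
  assumes "linear_relation \<Theta>"
  shows "linear_relation (extension \<Theta>)"
proof (rule linear_relationI)
  show "(0, 0) \<in> extension \<Theta>"
    using A_subset_extension[OF linear_relation_zero[OF assms]] linear_operator_A
      linear_relation_zero[of A] by (auto simp: linear_operator_def)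
  show "(f + g, f' + g') \<in> extension \<Theta>"
    if "(f, f') \<in> extension \<Theta>" "(g, g') \<in> extension \<Theta>" for f f' g g'
    using that linear_relation_add[OF linear_relation_rel_adjoint, of f f' A g g']
      linear_relation_add[OF assms, of "\<Lambda>\<^sub>0 f" "\<Lambda>\<^sub>1 f" "\<Lambda>\<^sub>0 g" "\<Lambda>\<^sub>1 g"]
      clinear_on_add[OF clinear_\<Lambda>\<^sub>0 DomainI DomainI] clinear_on_add[OF clinear_\<Lambda>\<^sub>1 DomainI DomainI]
    by (auto simp: extension_iff)
  show "(a *\<^sub>C f, a *\<^sub>C f') \<in> extension \<Theta>" if "(f, f') \<in> extension \<Theta>" for a f f'
    using that linear_relation_scale[OF linear_relation_rel_adjoint, of f f' A a]
      linear_relation_scale[OF assms, of "\<Lambda>\<^sub>0 f" "\<Lambda>\<^sub>1 f" a]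
      clinear_on_scale[OF clinear_\<Lambda>\<^sub>0 DomainI] clinear_on_scale[OF clinear_\<Lambda>\<^sub>1 DomainI]
    by (auto simp: extension_iff)
qed

lemma intermediate_extension_extension:
  assumes "linear_relation \<Theta>"
  shows "intermediate_extension A (extension \<Theta>)"
proof -
  have "single_valued (extension \<Theta>)"
    using single_valued_adjoint by (rule single_valued_subset[rotated]) (auto simp: extension_def)
  then show ?thesis
    using linear_relation_extension[OF assms] A_subset_extension[OF linear_relation_zero[OF assms]]
    by (auto simp: intermediate_extension_def linear_operator_def extension_iff)
qed

lemma intermediate_extension_is_extension:
  assumes "intermediate_extension A E"
  obtains \<Theta> where "linear_relation \<Theta>" "E = extension \<Theta>"
proof
  define \<Theta> where "\<Theta> = (\<lambda>f. (\<Lambda>\<^sub>0 f, \<Lambda>\<^sub>1 f)) ` Domain E"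
  have E: "linear_relation E" "A \<subseteq> E" "E \<subseteq> rel_adjoint A"
    using assms by (auto simp: intermediate_extension_def linear_operator_def)
  have dom: "f \<in> Domain (rel_adjoint A)" if "f \<in> Domain E" for f
    using that E(3) by auto
  note sub = linear_relation_Domain[OF E(1)]
  show "linear_relation \<Theta>"
  proof (rule linear_relationI)
    show "(0, 0) \<in> \<Theta>"
      using clinear_on_zero[OF clinear_\<Lambda>\<^sub>0 subspace_Domain_adjoint]
        clinear_on_zero[OF clinear_\<Lambda>\<^sub>1 subspace_Domain_adjoint] complex_vector.subspace_0[OF sub]
      unfolding \<Theta>_def by (intro image_eqI[of _ _ 0]) auto
    show "(x + y, x' + y') \<in> \<Theta>" if xy: "(x, x') \<in> \<Theta>" "(y, y') \<in> \<Theta>" for x x' y y'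
    proof -
      obtain f g where "f \<in> Domain E" "g \<in> Domain E" "x = \<Lambda>\<^sub>0 f" "x' = \<Lambda>\<^sub>1 f" "y = \<Lambda>\<^sub>0 g" "y' = \<Lambda>\<^sub>1 g"
        using xy by (auto simp: \<Theta>_def)
      then show ?thesis
        using complex_vector.subspace_add[OF sub] dom unfolding \<Theta>_def
        by (intro image_eqI[of _ _ "f + g"])
          (simp_all add: clinear_on_add[OF clinear_\<Lambda>\<^sub>0] clinear_on_add[OF clinear_\<Lambda>\<^sub>1])
    qed
    show "(a *\<^sub>C x, a *\<^sub>C x') \<in> \<Theta>" if xy: "(x, x') \<in> \<Theta>" for a x x'
    proof -
      obtain f where "f \<in> Domain E" "x = \<Lambda>\<^sub>0 f" "x' = \<Lambda>\<^sub>1 f"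
        using xy by (auto simp: \<Theta>_def)
      then show ?thesis
        using complex_vector.subspace_scale[OF sub] dom unfolding \<Theta>_def
        by (intro image_eqI[of _ _ "a *\<^sub>C f"])
          (simp_all add: clinear_on_scale[OF clinear_\<Lambda>\<^sub>0] clinear_on_scale[OF clinear_\<Lambda>\<^sub>1])
    qed
  qed
  show "E = extension \<Theta>"
  proof (intro equalityI subrelI)
    fix f f' assume "(f, f') \<in> E"
    then show "(f, f') \<in> extension \<Theta>" using E(3) by (auto simp: extension_iff \<Theta>_def)
  next
    fix f f' assume f: "(f, f') \<in> extension \<Theta>"
    then obtain g g' where g: "(g, g') \<in> E" "\<Lambda>\<^sub>0 f = \<Lambda>\<^sub>0 g" "\<Lambda>\<^sub>1 f = \<Lambda>\<^sub>1 g"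
      by (auto simp: extension_iff \<Theta>_def)
    (* f and g have the same boundary values, so they differ by an element of dom A *)
    have "(f - g, f' - g') \<in> rel_adjoint A"
      using f g(1) E(3) linear_relation_diff[OF linear_relation_rel_adjoint, of f f' A g g']
      by (auto simp: extension_iff)
    moreover have "\<Lambda>\<^sub>0 (f - g) = 0" "\<Lambda>\<^sub>1 (f - g) = 0"
      using f g E(3) clinear_on_diff[OF clinear_\<Lambda>\<^sub>0 subspace_Domain_adjoint, of f g]
        clinear_on_diff[OF clinear_\<Lambda>\<^sub>1 subspace_Domain_adjoint, of f g]
      by (auto simp: extension_iff)
    ultimately have "(f - g, f' - g') \<in> E" using E(2) by (auto simp: A_iff)
    from linear_relation_add[OF E(1) this g(1)] show "(f, f') \<in> E" by simp
  qed
qed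

lemma bij_betw_extension:
  assumes "\<And>\<Theta>. linear_relation \<Theta> \<Longrightarrow> P \<Theta> \<longleftrightarrow> Q (extension \<Theta>)"
  shows "bij_betw extension {\<Theta>. linear_relation \<Theta> \<and> P \<Theta>} {E. intermediate_extension A E \<and> Q E}"
proof (rule bij_betw_imageI)
  show "inj_on extension {\<Theta>. linear_relation \<Theta> \<and> P \<Theta>}"
    by (simp add: inj_on_def extension_eq_iff)
  show "extension ` {\<Theta>. linear_relation \<Theta> \<and> P \<Theta>} = {E. intermediate_extension A E \<and> Q E}"
    using assms intermediate_extension_extension
    by (blast elim: intermediate_extension_is_extension)
qed

text \<open>The adjoint of an extension lies in \<open>A\<^sup>*\<close>, where Green's identity turns the adjoint condition
  for \<open>(g, g')\<close> into the adjoint condition for the boundary values of \<open>g\<close>. Surjectivity makes every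
  pair in \<open>\<Theta>\<close> available as a test pair.\<close>

lemma adjoint_extension:
  assumes "(0, 0) \<in> \<Theta>"
  shows "rel_adjoint (extension \<Theta>) = extension (rel_adjoint \<Theta>)"
proof (intro equalityI subrelI)
  fix g g' assume *: "(g, g') \<in> rel_adjoint (extension \<Theta>)"
  then have g: "(g, g') \<in> rel_adjoint A"
    using rel_adjoint_antimono[OF A_subset_extension[OF assms]] by auto
  have "cinner x' (\<Lambda>\<^sub>0 g) = cinner x (\<Lambda>\<^sub>1 g)" if "(x, x') \<in> \<Theta>" for x x'
  proof -
    obtain f f' where f: "(f, f') \<in> rel_adjoint A" "\<Lambda>\<^sub>0 f = x" "\<Lambda>\<^sub>1 f = x'"
      by (rule obtain_boundary_values)
    then have "cinner f' g = cinner f g'" using * that by (auto simp: rel_adjoint_iff extension_iff)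
    then show ?thesis using Green[OF f(1) g] f(2,3) by simp
  qed
  then show "(g, g') \<in> extension (rel_adjoint \<Theta>)" using g by (simp add: extension_iff rel_adjoint_iff)
next
  fix g g' assume g: "(g, g') \<in> extension (rel_adjoint \<Theta>)"
  have "cinner f' g = cinner f g'" if f: "(f, f') \<in> extension \<Theta>" for f f'
    using Green[of f f' g g'] f g unfolding extension_iff rel_adjoint_iff[of _ _ \<Theta>] by auto
  then show "(g, g') \<in> rel_adjoint (extension \<Theta>)" by (simp add: rel_adjoint_iff)
qed

text \<open>Closed subspaces are the fixed points of the double adjoint, which commutes with
  \<open>extension\<close>.\<close>

lemma closed_extension_iff:
  assumes "linear_relation \<Theta>"
  shows "closed (extension \<Theta>) \<longleftrightarrow> closed \<Theta>"
proof -
  have "rel_adjoint (rel_adjoint (extension \<Theta>)) = extension (rel_adjoint (rel_adjoint \<Theta>))"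
    using assms linear_relation_zero linear_relation_rel_adjoint by (metis adjoint_extension)
  then show ?thesis
    using double_adjoint[OF assms] double_adjoint[OF linear_relation_extension[OF assms]]
    by (metis closed_rel_adjoint extension_eq_iff)
qed

lemma symmetric_extension_iff:
  "linear_relation \<Theta> \<Longrightarrow> symmetric (extension \<Theta>) \<longleftrightarrow> symmetric \<Theta>"
  by (simp add: symmetric_def adjoint_extension linear_relation_zero extension_subset_iff)

lemma self_adjoint_extension_iff:
  "linear_relation \<Theta> \<Longrightarrow> self_adjoint (extension \<Theta>) \<longleftrightarrow> self_adjoint \<Theta>"
  by (simp add: self_adjoint_def adjoint_extension linear_relation_zero extension_eq_iff)

text \<open>Green's identity with \<open>g = f\<close>: both sides are \<open>2 \<i>\<close> times the imaginary parts.\<close>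

lemma Im_Green:
  assumes "(f, f') \<in> rel_adjoint A"
  shows "Im (cinner f' f) = Im (cinner (\<Lambda>\<^sub>1 f) (\<Lambda>\<^sub>0 f))"
proof -
  have *: "Im (x - cnj x) = 2 * Im x" for x by simp
  show ?thesis
    using arg_cong[OF Green[OF assms assms], of Im] cinner_commute[of f f']
      cinner_commute[of "\<Lambda>\<^sub>0 f" "\<Lambda>\<^sub>1 f"] * by (metis mult_cancel_left zero_neq_numeral)
qed

lemma signed_dissipative_extension_iff:
  "signed_dissipative s (extension \<Theta>) \<longleftrightarrow> signed_dissipative s \<Theta>"
proof
  assume *: "signed_dissipative s (extension \<Theta>)"
  have "0 \<le> s * Im (cinner x' x)" if "(x, x') \<in> \<Theta>" for x x'
  proof -
    obtain f f' where f: "(f, f') \<in> rel_adjoint A" "\<Lambda>\<^sub>0 f = x" "\<Lambda>\<^sub>1 f = x'"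
      by (rule obtain_boundary_values)
    then have "0 \<le> s * Im (cinner f' f)"
      using * that by (auto simp: signed_dissipative_def extension_def)
    then show ?thesis using Im_Green[OF f(1)] f by simp
  qed
  then show "signed_dissipative s \<Theta>" by (auto simp: signed_dissipative_def)
next
  assume *: "signed_dissipative s \<Theta>"
  have "0 \<le> s * Im (cinner f' f)" if "(f, f') \<in> extension \<Theta>" for f f'
    using Im_Green[of f f'] that * by (auto simp: extension_iff signed_dissipative_def)
  then show "signed_dissipative s (extension \<Theta>)" by (auto simp: signed_dissipative_def)
qed

lemma maximal_signed_dissipative_extension_iff:
  assumes "linear_relation \<Theta>" "s \<noteq> 0" "signed_dissipative s \<Theta>"
  shows "(\<forall>E. linear_operator E \<and> signed_dissipative s E \<and> extension \<Theta> \<subseteq> E \<longrightarrow> E = extension \<Theta>) \<longleftrightarrow>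
    (\<forall>\<Theta>'. linear_relation \<Theta>' \<and> signed_dissipative s \<Theta>' \<and> \<Theta> \<subseteq> \<Theta>' \<longrightarrow> \<Theta>' = \<Theta>)"
    (is "?L \<longleftrightarrow> ?R")
proof
  assume L: ?L
  show ?R
  proof (intro allI impI)
    fix \<Theta>' assume "linear_relation \<Theta>' \<and> signed_dissipative s \<Theta>' \<and> \<Theta> \<subseteq> \<Theta>'"
    then have "extension \<Theta>' = extension \<Theta>"
      using L[rule_format, of "extension \<Theta>'"] intermediate_extension_extension[of \<Theta>']
      by (simp add: signed_dissipative_extension_iff extension_subset_iff intermediate_extension_def)
    then show "\<Theta>' = \<Theta>" by (simp add: extension_eq_iff)
  qed
next
  assume R: ?R
  show ?L
  proof (intro allI impI)
    fix E assume E: "linear_operator E \<and> signed_dissipative s E \<and> extension \<Theta> \<subseteq> E"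
    then have "A \<subseteq> E" using A_subset_extension[OF linear_relation_zero[OF assms(1)]] by auto
    then have "intermediate_extension A E"
      using E signed_dissipative_extension_subset_adjoint[of E s A] assms(2) symmetric_A
      by (simp add: intermediate_extension_def linear_operator_def)
    then obtain \<Theta>' where "linear_relation \<Theta>'" "E = extension \<Theta>'"
      by (rule intermediate_extension_is_extension)
    then show "E = extension \<Theta>"
      using E R by (metis signed_dissipative_extension_iff extension_subset_iff)
  qed
qed

lemma maximal_dissipative_extension_iff:
  assumes "linear_relation \<Theta>"
  shows "maximal_dissipative linear_operator (extension \<Theta>) \<longleftrightarrow>
    maximal_dissipative linear_relation \<Theta>"
  using maximal_signed_dissipative_extension_iff[OF assms, of 1]
  unfolding maximal_dissipative_def dissipative_signed signed_dissipative_extension_iff by auto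

lemma maximal_accumulative_extension_iff:
  assumes "linear_relation \<Theta>"
  shows "maximal_accumulative linear_operator (extension \<Theta>) \<longleftrightarrow>
    maximal_accumulative linear_relation \<Theta>"
  using maximal_signed_dissipative_extension_iff[OF assms, of "-1"]
  unfolding maximal_accumulative_def accumulative_signed signed_dissipative_extension_iff by auto

end

section \<open>Anti-duals and resolvents\<close>

lemma antilinear_on_zero:
  assumes "antilinear_on V \<phi>" "complex_vector.subspace V"
  shows "\<phi> 0 = 0"
  using assms complex_vector.subspace_0[OF assms(2)]
  by (metis antilinear_on_def complex_cnj_zero complex_vector.scale_zero_left mult_zero_left)

lemma antidual_le_dual_norm:
  assumes V: "complex_vector.subspace V" "norm_on V N" and \<phi>: "\<phi> \<in> antidual V N" and x: "x \<in> V"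
  shows "cmod (\<phi> x) \<le> dual_norm V N \<phi> * N x"
proof (cases "x = 0")
  case True
  then show ?thesis
    using antilinear_on_zero[OF _ V(1), of \<phi>] \<phi> V x by (auto simp: antidual_def norm_on_def)
next
  case False
  then have Nx: "N x > 0" using V(2) x by (auto simp: norm_on_def order_less_le)
  obtain C where C: "\<And>x. x \<in> V \<Longrightarrow> cmod (\<phi> x) \<le> C * N x" using \<phi> by (auto simp: antidual_def)
  have "bdd_above ((\<lambda>x. cmod (\<phi> x)) ` {x \<in> V. N x \<le> 1})"
  proof (rule bdd_aboveI2)
    fix y assume y: "y \<in> {x \<in> V. N x \<le> 1}"
    then have "0 \<le> N y" using V(2) by (auto simp: norm_on_def)
    have "cmod (\<phi> y) \<le> C * N y" using C y by auto
    also have "\<dots> \<le> \<bar>C\<bar> * N y" using \<open>0 \<le> N y\<close> by (intro mult_right_mono) auto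
    also have "\<dots> \<le> \<bar>C\<bar>" using y \<open>0 \<le> N y\<close> by (auto intro: mult_right_le_one_le)
    finally show "cmod (\<phi> y) \<le> \<bar>C\<bar>" .
  qed
  moreover define y where "y = complex_of_real (1 / N x) *\<^sub>C x"
  moreover have "y \<in> V" "N y = 1"
    using V x Nx by (auto simp: y_def complex_vector.subspace_scale norm_on_def norm_divide)
  ultimately have "cmod (\<phi> y) \<le> dual_norm V N \<phi>"
    unfolding dual_norm_def by (intro cSUP_upper) auto
  moreover have "\<phi> y = complex_of_real (1 / N x) * \<phi> x"
    using \<phi> x by (auto simp: y_def antidual_def antilinear_on_def)
  ultimately show ?thesis using Nx by (simp add: norm_divide field_simps)
qed

lemma antidual_embed_inject:
  assumes "closure V = UNIV" "antidual_embed V x = antidual_embed V y"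
  shows "x = y"
proof -
  have "cinner (x - y) v = 0" if "v \<in> V" for v
    using fun_cong[OF assms(2), of v] that by (simp add: antidual_embed_def cinner_diff_left)
  then have "x - y = 0" using orthogonal_to_dense_eq_0[OF assms(1)] by blast
  then show ?thesis by simp
qed

lemma resolvent_mem:
  assumes "z \<in> resolvent_set S"
  shows "(resolvent S z h, h + z *\<^sub>C resolvent S z h) \<in> S"
  using assms theI'[of "\<lambda>f. (f, h + z *\<^sub>C f) \<in> S"] by (simp add: resolvent_set_def resolvent_def)

lemma resolvent_eqI:
  assumes "z \<in> resolvent_set S" "(f, h + z *\<^sub>C f) \<in> S"
  shows "resolvent S z h = f"
proof -
  have "\<exists>!f. (f, h + z *\<^sub>C f) \<in> S" using assms(1) by (simp add: resolvent_set_def)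
  then show ?thesis using assms(2) resolvent_mem[OF assms(1), of h] by blast
qed

text \<open>Solvability of \<open>(S - z) v = u\<close> for every \<open>u\<close> makes \<open>S\<^sup>* - cnj z\<close> injective.\<close>

lemma resolvent_cnj_eqI:
  assumes S: "linear_relation S" "self_adjoint S" "z \<in> resolvent_set S"
    and f: "(f, h + cnj z *\<^sub>C f) \<in> S"
  shows "resolvent S (cnj z) h = f"
  unfolding resolvent_def
proof (rule the_equality)
  show "(f, h + cnj z *\<^sub>C f) \<in> S" by fact
  fix g assume g: "(g, h + cnj z *\<^sub>C g) \<in> S"
  define u where "u = g - f"
  define v where "v = resolvent S z u"
  have u: "(u, cnj z *\<^sub>C u) \<in> S"
    using linear_relation_diff[OF S(1) g f]
    by (simp add: u_def complex_vector.scale_right_diff_distrib)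
  have "(v, u + z *\<^sub>C v) \<in> rel_adjoint S"
    using resolvent_mem[OF S(3)] S(2) by (simp add: v_def self_adjoint_def)
  then have "cinner (cnj z *\<^sub>C u) v = cinner u (u + z *\<^sub>C v)" using u by (auto simp: rel_adjoint_iff)
  then have "cinner u u = 0" by (simp add: cinner_simps)
  then show "g = f" by (simp add: u_def)
qed

section \<open>The regularized boundary triple of a quasi boundary triple\<close>

locale extended_quasi_boundary_triple =
  fixes A T A\<^sub>0 :: "('h::complex_hilbert \<times> 'h) set"
    and \<Gamma>\<^sub>0 \<Gamma>\<^sub>1 :: "'h \<Rightarrow> 'g::complex_hilbert"
    and G\<^sub>0 G\<^sub>1 :: "'g set"
    and N\<^sub>0 N\<^sub>1 :: "'g \<Rightarrow> real"
    and \<Gamma>\<^sub>0' \<Gamma>\<^sub>1' :: "'h \<Rightarrow> 'g \<Rightarrow> complex"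
    and \<iota>p :: "'g \<Rightarrow> 'g"
    and \<iota>m :: "('g \<Rightarrow> complex) \<Rightarrow> 'g"
    and \<eta> :: complex
  assumes A\<^sub>0_eq: "A\<^sub>0 = restrict_op T (boundary_kernel T \<Gamma>\<^sub>0)"
    and G\<^sub>1_eq: "G\<^sub>1 = \<Gamma>\<^sub>1 ` boundary_kernel T \<Gamma>\<^sub>0"
    and linear_operator_A: "linear_operator A"
    and closed_A: "closed A"
    and dense_A: "closure (Domain A) = UNIV"
    and symmetric_A: "symmetric A"
    and quasi: "quasi_boundary_triple A T \<Gamma>\<^sub>0 \<Gamma>\<^sub>1"
    and \<eta>_resolvent: "\<eta> \<in> resolvent_set A\<^sub>0"
    and \<eta>_real: "cnj \<eta> = \<eta>"
    and dense_G\<^sub>0: "closure G\<^sub>0 = UNIV"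
    and norm_G\<^sub>1: "boundary_norm A\<^sub>0 \<Gamma>\<^sub>1 G\<^sub>1 N\<^sub>1"
    and ext_\<Gamma>\<^sub>0: "extended_boundary_map (rel_adjoint A) T \<Gamma>\<^sub>0 G\<^sub>1 N\<^sub>1 \<Gamma>\<^sub>0'"
    and ext_\<Gamma>\<^sub>1: "extended_boundary_map (rel_adjoint A) T \<Gamma>\<^sub>1 G\<^sub>0 N\<^sub>0 \<Gamma>\<^sub>1'"
    and iso_p: "isometric_isomorphism_on G\<^sub>1 N\<^sub>1 \<iota>p"
    and iso_m: "isometric_isomorphism_on (antidual G\<^sub>1 N\<^sub>1) (dual_norm G\<^sub>1 N\<^sub>1) \<iota>m"
    and pairing: "\<And>\<phi> x. \<phi> \<in> antidual G\<^sub>1 N\<^sub>1 \<Longrightarrow> x \<in> G\<^sub>1 \<Longrightarrow> cinner (\<iota>m \<phi>) (\<iota>p x) = \<phi> x"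
begin

lemma T_subset: "T \<subseteq> rel_adjoint A"
  and closure_T: "closure T = rel_adjoint A"
  and clinear_\<Gamma>\<^sub>0: "clinear_on (Domain T) \<Gamma>\<^sub>0"
  and clinear_\<Gamma>\<^sub>1: "clinear_on (Domain T) \<Gamma>\<^sub>1"
  and Green_T: "(f, f') \<in> T \<Longrightarrow> (g, g') \<in> T \<Longrightarrow>
        cinner f' g - cinner f g' = cinner (\<Gamma>\<^sub>1 f) (\<Gamma>\<^sub>0 g) - cinner (\<Gamma>\<^sub>0 f) (\<Gamma>\<^sub>1 g)"
  and dense_range: "closure ((\<lambda>f. (\<Gamma>\<^sub>0 f, \<Gamma>\<^sub>1 f)) ` Domain T) = UNIV"
  and self_adjoint_A\<^sub>0: "rel_adjoint A\<^sub>0 = A\<^sub>0"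
  using quasi unfolding quasi_boundary_triple_def linear_operator_def self_adjoint_def
  by (fastforce simp: A\<^sub>0_eq)+

lemma A\<^sub>0_iff: "(f, f') \<in> A\<^sub>0 \<longleftrightarrow> (f, f') \<in> T \<and> \<Gamma>\<^sub>0 f = 0"
  by (auto simp: A\<^sub>0_eq restrict_op_def boundary_kernel_def)

lemma A\<^sub>0_linear: "linear_relation A\<^sub>0"
  by (metis self_adjoint_A\<^sub>0 linear_relation_rel_adjoint)

lemma A\<^sub>0_subset_adjoint: "(f, f') \<in> A\<^sub>0 \<Longrightarrow> (f, f') \<in> rel_adjoint A"
  using T_subset A\<^sub>0_iff by blast

lemma G\<^sub>1_iff: "x \<in> G\<^sub>1 \<longleftrightarrow> (\<exists>f f'. (f, f') \<in> A\<^sub>0 \<and> x = \<Gamma>\<^sub>1 f)"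
  by (auto simp: A\<^sub>0_iff G\<^sub>1_eq boundary_kernel_def)

lemma norm_on_G\<^sub>1: "norm_on G\<^sub>1 N\<^sub>1" and subspace_G\<^sub>1: "complex_vector.subspace G\<^sub>1"
  using norm_G\<^sub>1 by (auto simp: boundary_norm_def banach_on_def)

lemma subspace_Domain_adjoint: "complex_vector.subspace (Domain (rel_adjoint A))"
  by (rule linear_relation_Domain[OF linear_relation_rel_adjoint])

lemma single_valued_adjoint: "single_valued (rel_adjoint A)"
  by (rule single_valued_rel_adjoint[OF dense_A])

lemma clinear_\<Gamma>\<^sub>0': "clinear_on (Domain (rel_adjoint A)) \<Gamma>\<^sub>0'"
  and clinear_\<Gamma>\<^sub>1': "clinear_on (Domain (rel_adjoint A)) \<Gamma>\<^sub>1'"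
  and \<Gamma>\<^sub>0'_antidual: "f \<in> Domain (rel_adjoint A) \<Longrightarrow> \<Gamma>\<^sub>0' f \<in> antidual G\<^sub>1 N\<^sub>1"
  and \<Gamma>\<^sub>0'_embed: "f \<in> Domain T \<Longrightarrow> \<Gamma>\<^sub>0' f = antidual_embed G\<^sub>1 (\<Gamma>\<^sub>0 f)"
  and \<Gamma>\<^sub>1'_embed: "f \<in> Domain T \<Longrightarrow> \<Gamma>\<^sub>1' f = antidual_embed G\<^sub>0 (\<Gamma>\<^sub>1 f)"
  using ext_\<Gamma>\<^sub>0 ext_\<Gamma>\<^sub>1 by (auto simp: extended_boundary_map_def)

lemma \<Gamma>\<^sub>0'_bounded:
  obtains C where "\<And>f f'. (f, f') \<in> rel_adjoint A \<Longrightarrow> dual_norm G\<^sub>1 N\<^sub>1 (\<Gamma>\<^sub>0' f) \<le> C * norm (f, f')"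
  using ext_\<Gamma>\<^sub>0 unfolding extended_boundary_map_def by fast

lemma \<Gamma>\<^sub>0'_A\<^sub>0:
  assumes "(f, f') \<in> A\<^sub>0"
  shows "\<Gamma>\<^sub>0' f = 0"
proof -
  have "f \<in> Domain T" "\<Gamma>\<^sub>0 f = 0" using assms by (auto simp: A\<^sub>0_iff)
  then show ?thesis by (simp add: \<Gamma>\<^sub>0'_embed antidual_embed_def fun_eq_iff)
qed

text \<open>Since \<open>A\<^sub>0 \<subseteq> A\<^sup>*\<close>, elements of \<open>A\<close> satisfy the adjoint condition for \<open>A\<^sub>0\<close>, and \<open>A\<^sub>0\<close> is its own
  adjoint.\<close>

lemma A_subset_A\<^sub>0: "A \<subseteq> A\<^sub>0"
proof (rule subrelI)
  fix u u' assume u: "(u, u') \<in> A"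
  have "cinner x' u = cinner x u'" if "(x, x') \<in> A\<^sub>0" for x x'
    using A\<^sub>0_subset_adjoint[OF that] u unfolding rel_adjoint_iff by (metis cinner_commute)
  then have "(u, u') \<in> rel_adjoint A\<^sub>0" by (simp add: rel_adjoint_iff)
  then show "(u, u') \<in> A\<^sub>0" by (simp add: self_adjoint_A\<^sub>0)
qed

text \<open>Green's identity makes \<open>\<Gamma>\<^sub>1 u\<close> orthogonal to the range of \<open>\<Gamma>\<^sub>0\<close>, which is dense.\<close>

lemma \<Gamma>\<^sub>1_A:
  assumes "(u, u') \<in> A"
  shows "\<Gamma>\<^sub>1 u = 0"
proof -
  have u: "(u, u') \<in> T" "\<Gamma>\<^sub>0 u = 0" using A_subset_A\<^sub>0 assms by (auto simp: A\<^sub>0_iff)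
  have "cinner (\<Gamma>\<^sub>1 u) (\<Gamma>\<^sub>0 g) = 0" if "(g, g') \<in> T" for g g'
  proof -
    have "cinner u' g = cinner u g'" using T_subset that assms by (auto simp: rel_adjoint_iff)
    then show ?thesis using Green_T[OF u(1) that] u(2) by simp
  qed
  then have "(\<lambda>f. (\<Gamma>\<^sub>0 f, \<Gamma>\<^sub>1 f)) ` Domain T \<subseteq> {p. cinner (\<Gamma>\<^sub>1 u) (fst p) = 0}" by auto
  moreover have "closed {p :: 'g \<times> 'g. cinner (\<Gamma>\<^sub>1 u) (fst p) = 0}"
    by (intro closed_Collect_eq continuous_on_cinner_right continuous_intros)
  ultimately have "UNIV \<subseteq> {p :: 'g \<times> 'g. cinner (\<Gamma>\<^sub>1 u) (fst p) = 0}"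
    using closure_minimal dense_range by metis
  then have "(\<Gamma>\<^sub>1 u, 0) \<in> {p :: 'g \<times> 'g. cinner (\<Gamma>\<^sub>1 u) (fst p) = 0}" by blast
  then show ?thesis by simp
qed

text \<open>The identity holds on \<open>T\<close>, where \<open>\<Gamma>\<^sub>0 g = 0\<close> removes one boundary term. Both sides are continuous in
  the graph norm and \<open>T\<close> is dense in \<open>A\<^sup>*\<close>.\<close>

lemma Green_extended:
  assumes f: "(f, f') \<in> rel_adjoint A" and g: "(g, g') \<in> A\<^sub>0"
  shows "cinner f' g - cinner f g' = - \<Gamma>\<^sub>0' f (\<Gamma>\<^sub>1 g)"
proof -
  obtain C where C: "\<And>f f'. (f, f') \<in> rel_adjoint A \<Longrightarrow>
      dual_norm G\<^sub>1 N\<^sub>1 (\<Gamma>\<^sub>0' f) \<le> C * norm (f, f')" using \<Gamma>\<^sub>0'_bounded by blast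
  have x: "\<Gamma>\<^sub>1 g \<in> G\<^sub>1" using g G\<^sub>1_iff by blast
  have Nx: "0 \<le> N\<^sub>1 (\<Gamma>\<^sub>1 g)" using x norm_on_G\<^sub>1 by (auto simp: norm_on_def)
  obtain F where F: "\<And>n. F n \<in> T" "F \<longlonglongrightarrow> (f, f')"
    using f closure_T closure_sequential by metis
  have "- \<Gamma>\<^sub>0' (fst (F n)) (\<Gamma>\<^sub>1 g) = cinner (snd (F n)) g - cinner (fst (F n)) g'" for n
  proof -
    have Fn: "(fst (F n), snd (F n)) \<in> T" using F(1) by simp
    then have "\<Gamma>\<^sub>0' (fst (F n)) = antidual_embed G\<^sub>1 (\<Gamma>\<^sub>0 (fst (F n)))" by (blast intro: \<Gamma>\<^sub>0'_embed)
    then show ?thesis using Green_T[OF Fn, of g g'] g x by (simp add: A\<^sub>0_iff antidual_embed_def)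
  qed
  moreover have "(\<lambda>n. cinner (snd (F n)) g - cinner (fst (F n)) g') \<longlonglongrightarrow> cinner f' g - cinner f g'"
    using tendsto_fst[OF F(2)] tendsto_snd[OF F(2)] by (intro tendsto_diff tendsto_cinner_left) auto
  ultimately have "(\<lambda>n. - \<Gamma>\<^sub>0' (fst (F n)) (\<Gamma>\<^sub>1 g)) \<longlonglongrightarrow> cinner f' g - cinner f g'" by simp
  moreover have "(\<lambda>n. - \<Gamma>\<^sub>0' (fst (F n)) (\<Gamma>\<^sub>1 g)) \<longlonglongrightarrow> - \<Gamma>\<^sub>0' f (\<Gamma>\<^sub>1 g)"
  proof (rule tendsto_minus, rule LIM_zero_cancel, rule Lim_null_comparison)
    show "\<forall>\<^sub>F n in sequentially. norm (\<Gamma>\<^sub>0' (fst (F n)) (\<Gamma>\<^sub>1 g) - \<Gamma>\<^sub>0' f (\<Gamma>\<^sub>1 g))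
        \<le> C * norm (F n - (f, f')) * N\<^sub>1 (\<Gamma>\<^sub>1 g)"
    proof (rule always_eventually, rule allI)
      fix n
      have Fn: "(fst (F n), snd (F n)) \<in> rel_adjoint A" using F(1) T_subset by auto
      have d: "(fst (F n) - f, snd (F n) - f') \<in> rel_adjoint A"
        using linear_relation_diff[OF linear_relation_rel_adjoint Fn f] .
      have "\<Gamma>\<^sub>0' (fst (F n) - f) = \<Gamma>\<^sub>0' (fst (F n)) - \<Gamma>\<^sub>0' f"
        by (rule clinear_on_diff[OF clinear_\<Gamma>\<^sub>0' subspace_Domain_adjoint DomainI[OF Fn] DomainI[OF f]])
      then have "norm (\<Gamma>\<^sub>0' (fst (F n)) (\<Gamma>\<^sub>1 g) - \<Gamma>\<^sub>0' f (\<Gamma>\<^sub>1 g)) = cmod (\<Gamma>\<^sub>0' (fst (F n) - f) (\<Gamma>\<^sub>1 g))"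
        by simp
      also have "\<dots> \<le> dual_norm G\<^sub>1 N\<^sub>1 (\<Gamma>\<^sub>0' (fst (F n) - f)) * N\<^sub>1 (\<Gamma>\<^sub>1 g)"
        using d by (intro antidual_le_dual_norm subspace_G\<^sub>1 norm_on_G\<^sub>1 \<Gamma>\<^sub>0'_antidual x) auto
      also have "\<dots> \<le> C * norm (fst (F n) - f, snd (F n) - f') * N\<^sub>1 (\<Gamma>\<^sub>1 g)"
        by (rule mult_right_mono[OF C[OF d] Nx])
      also have "(fst (F n) - f, snd (F n) - f') = F n - (f, f')" by (simp add: prod_eq_iff)
      finally show "norm (\<Gamma>\<^sub>0' (fst (F n)) (\<Gamma>\<^sub>1 g) - \<Gamma>\<^sub>0' f (\<Gamma>\<^sub>1 g))
        \<le> C * norm (F n - (f, f')) * N\<^sub>1 (\<Gamma>\<^sub>1 g)" .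
    qed
    have "(\<lambda>n. C * norm (F n - (f, f')) * N\<^sub>1 (\<Gamma>\<^sub>1 g)) \<longlonglongrightarrow> C * 0 * N\<^sub>1 (\<Gamma>\<^sub>1 g)"
      using F(2) by (intro tendsto_intros) (simp add: LIM_zero tendsto_norm_zero)
    then show "(\<lambda>n. C * norm (F n - (f, f')) * N\<^sub>1 (\<Gamma>\<^sub>1 g)) \<longlonglongrightarrow> 0" by simp
  qed
  ultimately show ?thesis by (rule LIMSEQ_unique)
qed

abbreviation K :: "'h \<Rightarrow> 'h" where "K \<equiv> resolvent A\<^sub>0 \<eta>"

lemmas K_mem = resolvent_mem[OF \<eta>_resolvent]

lemma K_eqI: "(f, h + \<eta> *\<^sub>C f) \<in> A\<^sub>0 \<Longrightarrow> K h = f"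
  using resolvent_eqI[OF \<eta>_resolvent] .

lemma K_add: "K (h + k) = K h + K k"
  using linear_relation_add[OF A\<^sub>0_linear K_mem[of h] K_mem[of k]]
  by (intro K_eqI) (simp add: algebra_simps complex_vector.scale_right_distrib)

lemma K_scale: "K (a *\<^sub>C h) = a *\<^sub>C K h"
  using linear_relation_scale[OF A\<^sub>0_linear K_mem[of h], of a]
  by (intro K_eqI) (simp add: complex_vector.scale_right_distrib mult.commute)

lemma \<Gamma>\<^sub>1_K_mem: "\<Gamma>\<^sub>1 (K h) \<in> G\<^sub>1"
  using K_mem G\<^sub>1_iff by blast

lemma K_Domain: "K h \<in> Domain T" "K h \<in> Domain (rel_adjoint A)"
  using K_mem[of h] A\<^sub>0_subset_adjoint A\<^sub>0_iff by blast+

lemma \<Gamma>\<^sub>1_K_add: "\<Gamma>\<^sub>1 (K (h + k)) = \<Gamma>\<^sub>1 (K h) + \<Gamma>\<^sub>1 (K k)"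
  by (simp add: K_add clinear_on_add[OF clinear_\<Gamma>\<^sub>1] K_Domain)

lemma \<Gamma>\<^sub>1_K_scale: "\<Gamma>\<^sub>1 (K (a *\<^sub>C h)) = a *\<^sub>C \<Gamma>\<^sub>1 (K h)"
  by (simp add: K_scale clinear_on_scale[OF clinear_\<Gamma>\<^sub>1] K_Domain)

lemma \<Gamma>\<^sub>1_K_surj:
  assumes "x \<in> G\<^sub>1"
  obtains h where "\<Gamma>\<^sub>1 (K h) = x"
proof -
  obtain f f' where f: "(f, f') \<in> A\<^sub>0" "x = \<Gamma>\<^sub>1 f" using assms G\<^sub>1_iff by blast
  have "K (f' - \<eta> *\<^sub>C f) = f" using f(1) by (intro K_eqI) simp
  then show ?thesis using that[of "f' - \<eta> *\<^sub>C f"] f(2) by simp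
qed

text \<open>Continuity is given at some point of the resolvent set of \<open>A\<^sub>0\<close>; the resolvent identity carries it
  over to \<open>\<eta>\<close>.\<close>

lemma \<Gamma>\<^sub>1_K_bounded: "\<exists>C. \<forall>h. N\<^sub>1 (\<Gamma>\<^sub>1 (K h)) \<le> C * norm h"
proof -
  obtain z C where z: "z \<in> resolvent_set A\<^sub>0"
    and C: "\<And>h. N\<^sub>1 (\<Gamma>\<^sub>1 (resolvent A\<^sub>0 (cnj z) h)) \<le> C * norm h"
    using norm_G\<^sub>1 by (auto simp: boundary_norm_def)
  have "bounded_linear K" using \<eta>_resolvent by (simp add: resolvent_set_def)
  then obtain B where B: "\<And>h. norm (K h) \<le> norm h * B" using bounded_linear.bounded by blast
  have "N\<^sub>1 (\<Gamma>\<^sub>1 (K h)) \<le> \<bar>C\<bar> * (1 + cmod (\<eta> - cnj z) * B) * norm h" for h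
  proof -
    define w where "w = h + (\<eta> - cnj z) *\<^sub>C K h"
    have "w + cnj z *\<^sub>C K h = h + \<eta> *\<^sub>C K h"
      by (simp add: w_def complex_vector.scale_left_diff_distrib)
    then have "resolvent A\<^sub>0 (cnj z) w = K h"
      using K_mem[of h] self_adjoint_A\<^sub>0 by (intro resolvent_cnj_eqI[OF A\<^sub>0_linear _ z])
        (simp_all add: self_adjoint_def)
    then have "N\<^sub>1 (\<Gamma>\<^sub>1 (K h)) \<le> C * norm w" using C[of w] by simp
    also have "\<dots> \<le> \<bar>C\<bar> * norm w" by (intro mult_right_mono) auto
    also have "\<dots> \<le> \<bar>C\<bar> * (norm h + cmod (\<eta> - cnj z) * (norm h * B))"
    proof (rule mult_left_mono)
      have "norm w \<le> norm h + cmod (\<eta> - cnj z) * norm (K h)"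
        unfolding w_def by (metis norm_scaleC norm_triangle_ineq)
      also have "\<dots> \<le> norm h + cmod (\<eta> - cnj z) * (norm h * B)"
        by (intro add_left_mono mult_left_mono B) auto
      finally show "norm w \<le> norm h + cmod (\<eta> - cnj z) * (norm h * B)" .
    qed simp
    finally show ?thesis by (simp add: algebra_simps)
  qed
  then show ?thesis by (intro exI allI)
qed

abbreviation ker\<^sub>\<eta> :: "'h set" where "ker\<^sub>\<eta> \<equiv> eigenspace (rel_adjoint A) \<eta>"

lemma ker_\<eta>_Domain: "f \<in> ker\<^sub>\<eta> \<Longrightarrow> f \<in> Domain (rel_adjoint A)"
  by (auto simp: eigenspace_def)

text \<open>The extended Green identity for \<open>f\<close> and \<open>K h\<close>, in which the terms with the real number \<open>\<eta>\<close>
  cancel. It says that \<open>\<Gamma>\<^sub>1 K\<close> is the adjoint of the inverse of \<open>\<Gamma>\<^sub>0'\<close> on the kernel.\<close>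

lemma cinner_ker_\<eta>:
  assumes "f \<in> ker\<^sub>\<eta>"
  shows "cinner f h = \<Gamma>\<^sub>0' f (\<Gamma>\<^sub>1 (K h))"
  using Green_extended[OF _ K_mem, of f "\<eta> *\<^sub>C f" h] assms \<eta>_real
  by (simp add: eigenspace_def cinner_simps)

lemma \<Gamma>\<^sub>0'_inj_ker_\<eta>:
  assumes "f \<in> ker\<^sub>\<eta>" "g \<in> ker\<^sub>\<eta>" "\<Gamma>\<^sub>0' f = \<Gamma>\<^sub>0' g"
  shows "f = g"
proof -
  have "cinner (f - g) (f - g) = 0"
    using cinner_ker_\<eta>[OF assms(1)] cinner_ker_\<eta>[OF assms(2)] assms(3)
    by (simp only: cinner_diff_left diff_self)
  then show ?thesis by simp
qed

text \<open>The candidate is the vector that represents the antilinear functional \<open>h \<mapsto> \<phi> (\<Gamma>\<^sub>1 (K h))\<close>. It lies in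
  the kernel because \<open>\<Gamma>\<^sub>1\<close> vanishes on \<open>A\<close>: for \<open>u \<in> dom A\<close> the functional vanishes at
  \<open>(A - \<eta>) u\<close>.\<close>

lemma \<Gamma>\<^sub>0'_surj_ker_\<eta>:
  assumes \<phi>: "\<phi> \<in> antidual G\<^sub>1 N\<^sub>1"
  obtains f where "f \<in> ker\<^sub>\<eta>" "\<Gamma>\<^sub>0' f = \<phi>"
proof -
  obtain C where C: "\<And>h. N\<^sub>1 (\<Gamma>\<^sub>1 (K h)) \<le> C * norm h" using \<Gamma>\<^sub>1_K_bounded by blast
  obtain D where D: "\<And>x. x \<in> G\<^sub>1 \<Longrightarrow> cmod (\<phi> x) \<le> D * N\<^sub>1 x" using \<phi> by (auto simp: antidual_def)
  have bd: "cmod (\<phi> (\<Gamma>\<^sub>1 (K h))) \<le> \<bar>D\<bar> * C * norm h" for h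
  proof -
    have "cmod (\<phi> (\<Gamma>\<^sub>1 (K h))) \<le> D * N\<^sub>1 (\<Gamma>\<^sub>1 (K h))" by (rule D[OF \<Gamma>\<^sub>1_K_mem])
    also have "\<dots> \<le> \<bar>D\<bar> * N\<^sub>1 (\<Gamma>\<^sub>1 (K h))"
      using norm_on_G\<^sub>1 \<Gamma>\<^sub>1_K_mem by (intro mult_right_mono) (auto simp: norm_on_def)
    also have "\<dots> \<le> \<bar>D\<bar> * (C * norm h)" by (intro mult_left_mono C) auto
    finally show ?thesis by (simp add: mult.assoc)
  qed
  have "antilinear_on UNIV (\<lambda>h. \<phi> (\<Gamma>\<^sub>1 (K h)))"
    using \<phi> \<Gamma>\<^sub>1_K_mem by (simp add: antilinear_on_def antidual_def \<Gamma>\<^sub>1_K_add \<Gamma>\<^sub>1_K_scale)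
  then obtain f where f: "\<And>h. cinner f h = \<phi> (\<Gamma>\<^sub>1 (K h))"
    using Riesz_representation_antilinear[OF _ bd] by blast
  have "cinner u' f = cinner u (\<eta> *\<^sub>C f)" if u: "(u, u') \<in> A" for u u'
  proof -
    have "K (u' - \<eta> *\<^sub>C u) = u" using A_subset_A\<^sub>0 u by (intro K_eqI) auto
    then have "cinner f (u' - \<eta> *\<^sub>C u) = 0"
      using \<Gamma>\<^sub>1_A[OF u] f[of "u' - \<eta> *\<^sub>C u"] \<phi> antilinear_on_zero[OF _ subspace_G\<^sub>1]
      by (simp add: antidual_def)
    then have "cinner f u' = cinner (\<eta> *\<^sub>C f) u" by (simp add: cinner_simps \<eta>_real)
    then show ?thesis by (metis cinner_commute)
  qed
  then have ker: "f \<in> ker\<^sub>\<eta>" by (simp add: eigenspace_def rel_adjoint_iff)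
  have "\<Gamma>\<^sub>0' f x = \<phi> x" for x
  proof (cases "x \<in> G\<^sub>1")
    case True
    then show ?thesis using \<Gamma>\<^sub>1_K_surj cinner_ker_\<eta>[OF ker] f by metis
  next
    case False
    then show ?thesis using \<phi> \<Gamma>\<^sub>0'_antidual[OF ker_\<eta>_Domain[OF ker]] by (simp add: antidual_def)
  qed
  then show ?thesis using that ker by blast
qed

text \<open>The component \<open>f\<^sub>0 = (A\<^sub>0 - \<eta>)\<inverse> (A\<^sup>* - \<eta>) f\<close> of \<open>f\<close> in \<open>dom A\<^sub>0\<close>; the description operator yields
  \<open>A\<^sup>* f\<close>, as \<open>A\<^sup>*\<close> is single-valued.\<close>

definition regular_part :: "'h \<Rightarrow> 'h" where
  "regular_part f = K ((THE f'. (f, f') \<in> rel_adjoint A) - \<eta> *\<^sub>C f)"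

definition reg_\<Gamma>\<^sub>0 :: "'h \<Rightarrow> 'g" where
  "reg_\<Gamma>\<^sub>0 f = \<iota>m (\<Gamma>\<^sub>0' f)"

definition reg_\<Gamma>\<^sub>1 :: "'h \<Rightarrow> 'g" where
  "reg_\<Gamma>\<^sub>1 f = \<iota>p (\<Gamma>\<^sub>1 (regular_part f))"

lemma regular_part_eq:
  assumes "(f, f') \<in> rel_adjoint A"
  shows "regular_part f = K (f' - \<eta> *\<^sub>C f)"
proof -
  have "(THE f'. (f, f') \<in> rel_adjoint A) = f'"
    using assms single_valued_adjoint by (blast dest: single_valuedD)
  then show ?thesis by (simp add: regular_part_def)
qed

lemma singular_part:
  assumes "(f, f') \<in> rel_adjoint A"
  shows "f - regular_part f \<in> ker\<^sub>\<eta>"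
  using linear_relation_diff[OF linear_relation_rel_adjoint assms
      A\<^sub>0_subset_adjoint[OF K_mem[of "f' - \<eta> *\<^sub>C f"]]]
  by (simp add: regular_part_eq[OF assms] eigenspace_def complex_vector.scale_right_diff_distrib)

lemma regular_part_mem:
  "(regular_part f, (THE f'. (f, f') \<in> rel_adjoint A) - \<eta> *\<^sub>C f + \<eta> *\<^sub>C regular_part f) \<in> A\<^sub>0"
  unfolding regular_part_def by (rule K_mem)

lemma \<Gamma>\<^sub>1_regular_part_mem: "\<Gamma>\<^sub>1 (regular_part f) \<in> G\<^sub>1"
  unfolding regular_part_def by (rule \<Gamma>\<^sub>1_K_mem)

lemma regular_part_Domain: "regular_part f \<in> Domain T" "regular_part f \<in> Domain (rel_adjoint A)"
  unfolding regular_part_def by (rule K_Domain)+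

lemma \<Gamma>\<^sub>0'_singular_part:
  assumes "f \<in> Domain (rel_adjoint A)"
  shows "\<Gamma>\<^sub>0' (f - regular_part f) = \<Gamma>\<^sub>0' f"
  using clinear_on_diff[OF clinear_\<Gamma>\<^sub>0' subspace_Domain_adjoint assms regular_part_Domain(2)]
    \<Gamma>\<^sub>0'_A\<^sub>0[OF regular_part_mem] by simp

lemma \<Gamma>\<^sub>1'_singular_part:
  assumes "f \<in> Domain (rel_adjoint A)"
  shows "\<Gamma>\<^sub>1' f = antidual_embed G\<^sub>0 (\<Gamma>\<^sub>1 (regular_part f)) + \<Gamma>\<^sub>1' (f - regular_part f)"
  using clinear_on_diff[OF clinear_\<Gamma>\<^sub>1' subspace_Domain_adjoint assms regular_part_Domain(2)]
    \<Gamma>\<^sub>1'_embed[OF regular_part_Domain(1)] by simp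

lemma reg_pairing:
  assumes f: "(f, f') \<in> rel_adjoint A" and g: "(g, g') \<in> rel_adjoint A"
  shows "cinner (reg_\<Gamma>\<^sub>0 f) (reg_\<Gamma>\<^sub>1 g) = cinner (f - regular_part f) (g' - \<eta> *\<^sub>C g)"
proof -
  have "cinner (reg_\<Gamma>\<^sub>0 f) (reg_\<Gamma>\<^sub>1 g) = \<Gamma>\<^sub>0' f (\<Gamma>\<^sub>1 (regular_part g))"
    unfolding reg_\<Gamma>\<^sub>0_def reg_\<Gamma>\<^sub>1_def using f \<Gamma>\<^sub>1_regular_part_mem
    by (intro pairing \<Gamma>\<^sub>0'_antidual) auto
  also have "\<dots> = \<Gamma>\<^sub>0' (f - regular_part f) (\<Gamma>\<^sub>1 (K (g' - \<eta> *\<^sub>C g)))"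
    using f by (subst \<Gamma>\<^sub>0'_singular_part) (auto simp: regular_part_eq[OF g])
  also have "\<dots> = cinner (f - regular_part f) (g' - \<eta> *\<^sub>C g)"
    by (rule cinner_ker_\<eta>[OF singular_part[OF f], symmetric])
  finally show ?thesis .
qed

text \<open>With \<open>h = (A\<^sup>* - \<eta>) f\<close> and \<open>k = (A\<^sup>* - \<eta>) g\<close> the left-hand side is \<open>(h, g) - (f, k)\<close>, while the
  boundary terms are \<open>(h, g - K k)\<close> and \<open>(f - K h, k)\<close>. The difference vanishes because the
  resolvent \<open>K\<close> of a self-adjoint operator at a real point is symmetric.\<close>

lemma reg_Green:
  assumes f: "(f, f') \<in> rel_adjoint A" and g: "(g, g') \<in> rel_adjoint A"
  shows "cinner f' g - cinner f g' =
    cinner (reg_\<Gamma>\<^sub>1 f) (reg_\<Gamma>\<^sub>0 g) - cinner (reg_\<Gamma>\<^sub>0 f) (reg_\<Gamma>\<^sub>1 g)"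
proof -
  define h where "h = f' - \<eta> *\<^sub>C f"
  define k where "k = g' - \<eta> *\<^sub>C g"
  have "(K k, k + \<eta> *\<^sub>C K k) \<in> rel_adjoint A\<^sub>0" using K_mem self_adjoint_A\<^sub>0 by simp
  then have "cinner (h + \<eta> *\<^sub>C K h) (K k) = cinner (K h) (k + \<eta> *\<^sub>C K k)"
    using K_mem[of h] by (auto simp: rel_adjoint_iff)
  then have sym: "cinner h (K k) = cinner (K h) k" by (simp add: cinner_simps \<eta>_real)
  have "cinner (reg_\<Gamma>\<^sub>0 g) (reg_\<Gamma>\<^sub>1 f) = cinner (g - K k) h"
    using reg_pairing[OF g f] regular_part_eq[OF g] unfolding h_def k_def by simp
  then have "cinner (reg_\<Gamma>\<^sub>1 f) (reg_\<Gamma>\<^sub>0 g) = cinner h (g - K k)"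
    by (subst (1 2) cinner_commute) simp
  moreover have "cinner (reg_\<Gamma>\<^sub>0 f) (reg_\<Gamma>\<^sub>1 g) = cinner (f - K h) k"
    using reg_pairing[OF f g] regular_part_eq[OF f] unfolding h_def k_def by simp
  moreover have "cinner f' g - cinner f g' = cinner h g - cinner f k"
    by (simp add: h_def k_def cinner_simps \<eta>_real)
  ultimately show ?thesis using sym by (simp add: cinner_simps)
qed

lemma reg_surj: "\<exists>f\<in>Domain (rel_adjoint A). reg_\<Gamma>\<^sub>0 f = x \<and> reg_\<Gamma>\<^sub>1 f = y"
proof -
  have "x \<in> \<iota>m ` antidual G\<^sub>1 N\<^sub>1" "y \<in> \<iota>p ` G\<^sub>1"
    using iso_m iso_p by (simp_all add: isometric_isomorphism_on_def bij_betw_def)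
  then obtain \<phi> x\<^sub>1 where \<phi>: "\<phi> \<in> antidual G\<^sub>1 N\<^sub>1" "\<iota>m \<phi> = x"
    and x1: "x\<^sub>1 \<in> G\<^sub>1" "\<iota>p x\<^sub>1 = y" by auto
  obtain s where s: "s \<in> ker\<^sub>\<eta>" "\<Gamma>\<^sub>0' s = \<phi>" by (rule \<Gamma>\<^sub>0'_surj_ker_\<eta>[OF \<phi>(1)])
  obtain h where h: "\<Gamma>\<^sub>1 (K h) = x\<^sub>1" by (rule \<Gamma>\<^sub>1_K_surj[OF x1(1)])
  have f: "(K h + s, h + \<eta> *\<^sub>C K h + \<eta> *\<^sub>C s) \<in> rel_adjoint A"
    using s(1) A\<^sub>0_subset_adjoint[OF K_mem[of h]]
    by (intro linear_relation_add[OF linear_relation_rel_adjoint]) (simp_all add: eigenspace_def)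
  have "\<Gamma>\<^sub>0' (K h + s) = \<Gamma>\<^sub>0' (K h) + \<Gamma>\<^sub>0' s"
    using K_Domain ker_\<eta>_Domain[OF s(1)] by (intro clinear_on_add[OF clinear_\<Gamma>\<^sub>0'])
  then have "reg_\<Gamma>\<^sub>0 (K h + s) = x" using \<Gamma>\<^sub>0'_A\<^sub>0[OF K_mem[of h]] s(2) \<phi>(2) by (simp add: reg_\<Gamma>\<^sub>0_def)
  moreover have "reg_\<Gamma>\<^sub>1 (K h + s) = y"
    using regular_part_eq[OF f] h x1(2)
    by (simp add: reg_\<Gamma>\<^sub>1_def complex_vector.scale_right_distrib)
  ultimately show ?thesis using f by blast
qed

lemma clinear_reg_\<Gamma>\<^sub>0: "clinear_on (Domain (rel_adjoint A)) reg_\<Gamma>\<^sub>0"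
proof -
  have "clinear_on (antidual G\<^sub>1 N\<^sub>1) \<iota>m" using iso_m by (simp add: isometric_isomorphism_on_def)
  then show ?thesis
    using clinear_\<Gamma>\<^sub>0' \<Gamma>\<^sub>0'_antidual unfolding clinear_on_def reg_\<Gamma>\<^sub>0_def by simp
qed

lemma clinear_reg_\<Gamma>\<^sub>1: "clinear_on (Domain (rel_adjoint A)) reg_\<Gamma>\<^sub>1"
proof -
  have \<iota>: "clinear_on G\<^sub>1 \<iota>p" using iso_p by (simp add: isometric_isomorphism_on_def)
  have add: "regular_part (f + g) = regular_part f + regular_part g"
    if fg: "(f, f') \<in> rel_adjoint A" "(g, g') \<in> rel_adjoint A" for f f' g g'
    using regular_part_eq[OF linear_relation_add[OF linear_relation_rel_adjoint fg]]
      K_add[of "f' - \<eta> *\<^sub>C f" "g' - \<eta> *\<^sub>C g"] regular_part_eq[OF fg(1)] regular_part_eq[OF fg(2)]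
    by (simp add: complex_vector.scale_right_distrib algebra_simps)
  have scale: "regular_part (a *\<^sub>C f) = a *\<^sub>C regular_part f" if f: "(f, f') \<in> rel_adjoint A" for a f f'
    using regular_part_eq[OF linear_relation_scale[OF linear_relation_rel_adjoint f, of a]]
      K_scale[of a "f' - \<eta> *\<^sub>C f"] regular_part_eq[OF f]
    by (simp add: complex_vector.scale_right_diff_distrib mult.commute)
  show ?thesis
    unfolding clinear_on_def
  proof (intro conjI ballI allI)
    fix f g assume "f \<in> Domain (rel_adjoint A)" "g \<in> Domain (rel_adjoint A)"
    then obtain f' g' where "(f, f') \<in> rel_adjoint A" "(g, g') \<in> rel_adjoint A" by auto
    then have "regular_part (f + g) = regular_part f + regular_part g" by (rule add)
    then show "reg_\<Gamma>\<^sub>1 (f + g) = reg_\<Gamma>\<^sub>1 f + reg_\<Gamma>\<^sub>1 g"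
      by (simp add: reg_\<Gamma>\<^sub>1_def clinear_on_add[OF clinear_\<Gamma>\<^sub>1] clinear_on_add[OF \<iota>]
          regular_part_Domain \<Gamma>\<^sub>1_regular_part_mem)
  next
    fix a f assume "f \<in> Domain (rel_adjoint A)"
    then obtain f' where "(f, f') \<in> rel_adjoint A" by auto
    then have "regular_part (a *\<^sub>C f) = a *\<^sub>C regular_part f" by (rule scale)
    then show "reg_\<Gamma>\<^sub>1 (a *\<^sub>C f) = a *\<^sub>C reg_\<Gamma>\<^sub>1 f"
      by (simp add: reg_\<Gamma>\<^sub>1_def clinear_on_scale[OF clinear_\<Gamma>\<^sub>1] clinear_on_scale[OF \<iota>]
          regular_part_Domain \<Gamma>\<^sub>1_regular_part_mem)
  qed
qed

sublocale boundary: ordinary_boundary_triple A reg_\<Gamma>\<^sub>0 reg_\<Gamma>\<^sub>1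
proof
  show "linear_operator A" "closed A" "closure (Domain A) = UNIV" "symmetric A"
    by (fact linear_operator_A closed_A dense_A symmetric_A)+
  show "clinear_on (Domain (rel_adjoint A)) reg_\<Gamma>\<^sub>0" "clinear_on (Domain (rel_adjoint A)) reg_\<Gamma>\<^sub>1"
    by (fact clinear_reg_\<Gamma>\<^sub>0 clinear_reg_\<Gamma>\<^sub>1)+
qed (fact reg_Green reg_surj)+

text \<open>By injectivity of \<open>\<Gamma>\<^sub>0'\<close> on the kernel, the only value of the Weyl function at \<open>\<Gamma>\<^sub>0' f\<close> is \<open>\<Gamma>\<^sub>1'\<close> of the
  singular part of \<open>f\<close>. Subtracting it from \<open>\<Gamma>\<^sub>1' f\<close> leaves the embedded vector \<open>\<Gamma>\<^sub>1 (regular_part f)\<close>,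
  and the embedding is injective because \<open>G\<^sub>0\<close> is dense.\<close>

lemma boundary_restriction_eq_extension:
  "boundary_restriction (rel_adjoint A) \<Gamma>\<^sub>0' \<Gamma>\<^sub>1'
     (boundary_parameter G\<^sub>0 (antidual G\<^sub>1 N\<^sub>1) \<iota>m G\<^sub>1 \<iota>p (weyl_function (rel_adjoint A) \<Gamma>\<^sub>0' \<Gamma>\<^sub>1' \<eta>) \<Theta>)
   = boundary.extension \<Theta>" (is "boundary_restriction _ _ _ ?\<theta> = _")
proof -
  have "(\<Gamma>\<^sub>0' f, \<Gamma>\<^sub>1' f) \<in> ?\<theta> \<longleftrightarrow> (reg_\<Gamma>\<^sub>0 f, reg_\<Gamma>\<^sub>1 f) \<in> \<Theta>" if f: "(f, f') \<in> rel_adjoint A" for f f'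
  proof -
    have dom: "f \<in> Domain (rel_adjoint A)" using f by blast
    define s\<^sub>0 where "s\<^sub>0 = f - regular_part f"
    have s0: "s\<^sub>0 \<in> ker\<^sub>\<eta>" "\<Gamma>\<^sub>0' s\<^sub>0 = \<Gamma>\<^sub>0' f"
      using singular_part[OF f] \<Gamma>\<^sub>0'_singular_part[OF dom] by (simp_all add: s\<^sub>0_def)
    have s: "s \<in> ker\<^sub>\<eta> \<and> \<Gamma>\<^sub>0' s = \<Gamma>\<^sub>0' f \<longleftrightarrow> s = s\<^sub>0" for s
      using \<Gamma>\<^sub>0'_inj_ker_\<eta>[of s s\<^sub>0] s0 by auto
    have W: "(\<Gamma>\<^sub>0' f, b) \<in> weyl_function (rel_adjoint A) \<Gamma>\<^sub>0' \<Gamma>\<^sub>1' \<eta> \<longleftrightarrow> b = \<Gamma>\<^sub>1' s\<^sub>0" for b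
    proof -
      have "(\<Gamma>\<^sub>0' f, b) \<in> weyl_function (rel_adjoint A) \<Gamma>\<^sub>0' \<Gamma>\<^sub>1' \<eta> \<longleftrightarrow>
          (\<exists>s. (s \<in> ker\<^sub>\<eta> \<and> \<Gamma>\<^sub>0' s = \<Gamma>\<^sub>0' f) \<and> s \<in> Domain (rel_adjoint A) \<and> b = \<Gamma>\<^sub>1' s)"
        by (auto simp: weyl_function_def gamma_field_def graph_on_def relcomp_unfold) (metis DomainI)
      then show ?thesis unfolding s using ker_\<eta>_Domain[OF s0(1)] by auto
    qed
    have I: "(\<Gamma>\<^sub>0' f, b) \<in> iota_transform (antidual G\<^sub>1 N\<^sub>1) \<iota>m G\<^sub>1 \<iota>p \<Theta> O graph_on G\<^sub>1 (antidual_embed G\<^sub>0)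
        \<longleftrightarrow> (\<exists>x\<in>G\<^sub>1. (reg_\<Gamma>\<^sub>0 f, \<iota>p x) \<in> \<Theta> \<and> b = antidual_embed G\<^sub>0 x)" for b
      using \<Gamma>\<^sub>0'_antidual[OF dom]
      by (auto simp: iota_transform_def graph_on_def relcomp_unfold reg_\<Gamma>\<^sub>0_def)
    have "(\<Gamma>\<^sub>0' f, \<Gamma>\<^sub>1' f) \<in> ?\<theta> \<longleftrightarrow> (\<exists>b b'. \<Gamma>\<^sub>1' f = b + b' \<and>
        (\<Gamma>\<^sub>0' f, b) \<in> iota_transform (antidual G\<^sub>1 N\<^sub>1) \<iota>m G\<^sub>1 \<iota>p \<Theta> O graph_on G\<^sub>1 (antidual_embed G\<^sub>0) \<and>
        (\<Gamma>\<^sub>0' f, b') \<in> weyl_function (rel_adjoint A) \<Gamma>\<^sub>0' \<Gamma>\<^sub>1' \<eta>)"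
      unfolding boundary_parameter_def rel_sum_def by simp
    also have "\<dots> \<longleftrightarrow>
        (\<exists>x\<in>G\<^sub>1. (reg_\<Gamma>\<^sub>0 f, \<iota>p x) \<in> \<Theta> \<and> \<Gamma>\<^sub>1' f = antidual_embed G\<^sub>0 x + \<Gamma>\<^sub>1' s\<^sub>0)"
      unfolding I W by blast
    also have "\<dots> \<longleftrightarrow> (\<exists>x\<in>G\<^sub>1. (reg_\<Gamma>\<^sub>0 f, \<iota>p x) \<in> \<Theta> \<and> x = \<Gamma>\<^sub>1 (regular_part f))"
      unfolding \<Gamma>\<^sub>1'_singular_part[OF dom] s\<^sub>0_def[symmetric] add_right_cancel
      using antidual_embed_inject[OF dense_G\<^sub>0] by auto
    also have "\<dots> \<longleftrightarrow> (reg_\<Gamma>\<^sub>0 f, reg_\<Gamma>\<^sub>1 f) \<in> \<Theta>"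
      using \<Gamma>\<^sub>1_regular_part_mem by (auto simp: reg_\<Gamma>\<^sub>1_def)
    finally show ?thesis .
  qed
  then show ?thesis
    by (auto simp: boundary_restriction_def restrict_op_def boundary.extension_def)
qed

text \<open>Equal values of \<open>\<Gamma>\<^sub>0'\<close> force equal singular parts, so \<open>f\<close> differs from an element of \<open>dom S\<close> by
  regular parts only, which lie in \<open>dom T\<close>.\<close>

lemma Domain_extension_subset:
  assumes S: "linear_operator S" "T \<subseteq> S" "S \<subseteq> rel_adjoint A"
    and dom: "Domain \<Theta> \<subseteq> (\<lambda>f. \<iota>m (\<Gamma>\<^sub>0' f)) ` Domain S"
  shows "Domain (boundary.extension \<Theta>) \<subseteq> Domain S"
proof
  fix f assume "f \<in> Domain (boundary.extension \<Theta>)"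
  then obtain f' where f: "(f, f') \<in> rel_adjoint A" "(reg_\<Gamma>\<^sub>0 f, reg_\<Gamma>\<^sub>1 f) \<in> \<Theta>"
    by (auto simp: boundary.extension_def)
  then obtain g g' where g: "(g, g') \<in> S" "\<iota>m (\<Gamma>\<^sub>0' f) = \<iota>m (\<Gamma>\<^sub>0' g)"
    using dom by (auto simp: reg_\<Gamma>\<^sub>0_def)
  have gA: "(g, g') \<in> rel_adjoint A" using g(1) S(3) by auto
  have "inj_on \<iota>m (antidual G\<^sub>1 N\<^sub>1)"
    using iso_m by (auto simp: isometric_isomorphism_on_def bij_betw_def)
  then have "\<Gamma>\<^sub>0' f = \<Gamma>\<^sub>0' g"
    using g(2) \<Gamma>\<^sub>0'_antidual f(1) gA by (metis DomainI inj_onD)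
  then have "f - regular_part f = g - regular_part g"
    using \<Gamma>\<^sub>0'_inj_ker_\<eta>[OF singular_part[OF f(1)] singular_part[OF gA]]
    by (simp add: \<Gamma>\<^sub>0'_singular_part[OF DomainI[OF f(1)]] \<Gamma>\<^sub>0'_singular_part[OF DomainI[OF gA]])
  then have eq: "f = g - regular_part g + regular_part f" by (simp add: algebra_simps)
  have "linear_relation S" using S(1) by (simp add: linear_operator_def)
  note sub = linear_relation_Domain[OF this]
  have "regular_part f \<in> Domain S" "regular_part g \<in> Domain S" "g \<in> Domain S"
    using regular_part_Domain(1) S(2) g(1) by blast+
  then show "f \<in> Domain S"
    by (subst eq) (intro complex_vector.subspace_add[OF sub] complex_vector.subspace_diff[OF sub])
qed

end

section \<open>Parametrization of the intermediate extensions\<close>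

theorem theorem3p7:
  fixes A T A\<^sub>0 A\<^sub>1 :: "('h::complex_hilbert \<times> 'h) set"
    and \<Gamma>\<^sub>0 \<Gamma>\<^sub>1 :: "'h \<Rightarrow> 'g::complex_hilbert"
    and G\<^sub>0 G\<^sub>1 :: "'g set"
    and N\<^sub>0 N\<^sub>1 :: "'g \<Rightarrow> real"
    and \<Gamma>\<^sub>0' \<Gamma>\<^sub>1' :: "'h \<Rightarrow> 'g \<Rightarrow> complex"
    and \<iota>p :: "'g \<Rightarrow> 'g"
    and \<iota>m :: "('g \<Rightarrow> complex) \<Rightarrow> 'g"
    and \<eta> :: complex
  defines "A\<^sub>0 \<equiv> restrict_op T (boundary_kernel T \<Gamma>\<^sub>0)"
    and "A\<^sub>1 \<equiv> restrict_op T (boundary_kernel T \<Gamma>\<^sub>1)"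
    and "G\<^sub>0 \<equiv> \<Gamma>\<^sub>0 ` boundary_kernel T \<Gamma>\<^sub>1"
    and "G\<^sub>1 \<equiv> \<Gamma>\<^sub>1 ` boundary_kernel T \<Gamma>\<^sub>0"
  defines "\<theta> \<equiv> boundary_parameter G\<^sub>0 (antidual G\<^sub>1 N\<^sub>1) \<iota>m G\<^sub>1 \<iota>p
                 (weyl_function (rel_adjoint A) \<Gamma>\<^sub>0' \<Gamma>\<^sub>1' \<eta>)"
  defines "\<A> \<equiv> \<lambda>\<Theta>. boundary_restriction (rel_adjoint A) \<Gamma>\<^sub>0' \<Gamma>\<^sub>1' (\<theta> \<Theta>)"
  assumes "separable_space (euclidean :: 'h topology)"
    and "linear_operator A" "closed A" "closure (Domain A) = UNIV" "symmetric A"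
    and "equal_deficiency_indices A"
    and "quasi_boundary_triple A T \<Gamma>\<^sub>0 \<Gamma>\<^sub>1"
    and "self_adjoint A\<^sub>1"
    and "\<eta> \<in> resolvent_set A\<^sub>0 \<inter> resolvent_set A\<^sub>1 \<inter> \<real>"
    and "closure G\<^sub>0 = UNIV" "closure G\<^sub>1 = UNIV"
    and "boundary_norm A\<^sub>1 \<Gamma>\<^sub>0 G\<^sub>0 N\<^sub>0" "boundary_norm A\<^sub>0 \<Gamma>\<^sub>1 G\<^sub>1 N\<^sub>1"
    and "extended_boundary_map (rel_adjoint A) T \<Gamma>\<^sub>0 G\<^sub>1 N\<^sub>1 \<Gamma>\<^sub>0'"
    and "extended_boundary_map (rel_adjoint A) T \<Gamma>\<^sub>1 G\<^sub>0 N\<^sub>0 \<Gamma>\<^sub>1'"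
    and "isometric_isomorphism_on G\<^sub>1 N\<^sub>1 \<iota>p"
    and "isometric_isomorphism_on (antidual G\<^sub>1 N\<^sub>1) (dual_norm G\<^sub>1 N\<^sub>1) \<iota>m"
    and "\<forall>\<phi>\<in>antidual G\<^sub>1 N\<^sub>1. \<forall>x\<in>G\<^sub>1. cinner (\<iota>m \<phi>) (\<iota>p x) = \<phi> x"
  shows
    "bij_betw \<A> {\<Theta>. linear_relation \<Theta> \<and> closed \<Theta>}
                {E. intermediate_extension A E \<and> closed E} \<and>
     bij_betw \<A> {\<Theta>. linear_relation \<Theta> \<and> symmetric \<Theta>}
                {E. intermediate_extension A E \<and> symmetric E} \<and>
     bij_betw \<A> {\<Theta>. linear_relation \<Theta> \<and> closed \<Theta> \<and> symmetric \<Theta>}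
                {E. intermediate_extension A E \<and> closed E \<and> symmetric E} \<and>
     bij_betw \<A> {\<Theta>. linear_relation \<Theta> \<and> self_adjoint \<Theta>}
                {E. intermediate_extension A E \<and> self_adjoint E} \<and>
     bij_betw \<A> {\<Theta>. linear_relation \<Theta> \<and> dissipative \<Theta>}
                {E. intermediate_extension A E \<and> dissipative E} \<and>
     bij_betw \<A> {\<Theta>. linear_relation \<Theta> \<and> closed \<Theta> \<and> dissipative \<Theta>}
                {E. intermediate_extension A E \<and> closed E \<and> dissipative E} \<and>
     bij_betw \<A> {\<Theta>. linear_relation \<Theta> \<and> maximal_dissipative linear_relation \<Theta>}
                {E. intermediate_extension A E \<and> maximal_dissipative linear_operator E} \<and>
     bij_betw \<A> {\<Theta>. linear_relation \<Theta> \<and> accumulative \<Theta>}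
                {E. intermediate_extension A E \<and> accumulative E} \<and>
     bij_betw \<A> {\<Theta>. linear_relation \<Theta> \<and> closed \<Theta> \<and> accumulative \<Theta>}
                {E. intermediate_extension A E \<and> closed E \<and> accumulative E} \<and>
     bij_betw \<A> {\<Theta>. linear_relation \<Theta> \<and> maximal_accumulative linear_relation \<Theta>}
                {E. intermediate_extension A E \<and> maximal_accumulative linear_operator E} \<and>
     (\<forall>\<Theta> S. linear_relation \<Theta> \<and> linear_operator S \<and> T \<subseteq> S \<and> S \<subseteq> rel_adjoint A \<longrightarrow>
       (Domain \<Theta> \<subseteq> (\<lambda>f. \<iota>m (\<Gamma>\<^sub>0' f)) ` Domain S \<longrightarrow> Domain (\<A> \<Theta>) \<subseteq> Domain S))"
proof -
  interpret extended_quasi_boundary_triple A T A\<^sub>0 \<Gamma>\<^sub>0 \<Gamma>\<^sub>1 G\<^sub>0 G\<^sub>1 N\<^sub>0 N\<^sub>1 \<Gamma>\<^sub>0' \<Gamma>\<^sub>1' \<iota>p \<iota>m \<eta>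
  proof unfold_locales
    show "A\<^sub>0 = restrict_op T (boundary_kernel T \<Gamma>\<^sub>0)" "G\<^sub>1 = \<Gamma>\<^sub>1 ` boundary_kernel T \<Gamma>\<^sub>0"
      by (simp_all only: A\<^sub>0_def G\<^sub>1_def)
    show "cnj \<eta> = \<eta>" "\<eta> \<in> resolvent_set A\<^sub>0" using assms(15) by (simp_all add: Reals_cnj_iff)
    show "cinner (\<iota>m \<phi>) (\<iota>p x) = \<phi> x" if "\<phi> \<in> antidual G\<^sub>1 N\<^sub>1" "x \<in> G\<^sub>1" for \<phi> x
      by (rule bspec[OF bspec[OF assms(24) that(1)] that(2)])
  qed (fact assms)+
  have eq: "\<A> = boundary.extension"
    unfolding \<A>_def \<theta>_def by (rule ext) (rule boundary_restriction_eq_extension)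
  show ?thesis
    unfolding eq
    by (intro conjI allI impI boundary.bij_betw_extension Domain_extension_subset)
      (simp_all add: boundary.closed_extension_iff boundary.symmetric_extension_iff
        boundary.self_adjoint_extension_iff dissipative_signed accumulative_signed
        boundary.signed_dissipative_extension_iff boundary.maximal_dissipative_extension_iff
        boundary.maximal_accumulative_extension_iff)
qed

end
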